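(* Let $k,\ell,n\ge 2$ be natural numbers such that $\ell\ge 2k-1$ and $n>2\ell^2$. Let $q$ be a prime power, let $\alpha_1,\ldots,\alpha_n\in\mathbb{F}_q$ be $n$ distinct elements and denote $\underline{\alpha}=(\alpha_1,\ldots,\alpha_n)$. Suppose that for every pair of increasing sequences $I,J\in[n]^\ell$ that agree on at most $k-1$ coordinates, we have $\mathrm{rk}(V_{k,\ell,I,J}(\underline{\alpha}))=2k-1$. Then there exists an $(\ell,k,q;1)$ Reed--Solomon sunflower with at least $p^k$ petals, for some prime $p$ satisfying $p\in[n/(2\ell),\,n/\ell]$. Moreover, there is an encoding algorithm that, given a message $m\in\mathbb{F}_p^k$, outputs a generator matrix of a Reed--Solomon code from this sunflower using $O(k\cdot\ell)$ operations over $\mathbb{F}_p$, $O(\ell)$ arithmetic operations over $\mathbb{Z}$ with all involved integers smaller than $n$, and $O(k\cdot\ell)$ operations over $\mathbb{F}_q$.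
   Context: $[n]=\{1,\ldots,n\}$. A sequence $I=(I_1,\ldots,I_\ell)\in[n]^\ell$ is increasing if $I_1<\cdots<I_\ell$. Two sequences $I,J\in[n]^\ell$ agree on at most $k-1$ coordinates if $|\{h\in[\ell] : I_h=J_h\}|\le k-1$. For increasing sequences $I,J\in[n]^\ell$, $V_{k,\ell,I,J}(X_1,\ldots,X_n)$ is the $\ell\times(2k-1)$ matrix whose $h$-th row is $(1,X_{I_h},X_{I_h}^2,\ldots,X_{I_h}^{k-1},X_{J_h},X_{J_h}^2,\ldots,X_{J_h}^{k-1})$; $V_{k,\ell,I,J}(\underline{\alpha})$ is its evaluation at $X_i=\alpha_i$. For $\underline{\beta}\in\mathbb{F}_q^\ell$ with pairwise distinct entries, the Reed--Solomon (RS) code is $\mathsf{RS}_{\ell,k}(\underline{\beta})=\{(f(\beta_1),\ldots,f(\beta_\ell)) : f\in\mathbb{F}_q[x],\ \deg f<k\}$. For $1\le c<k\le\ell\le q$, an $(\ell,k,q;c)$ Reed--Solomon sunflower is a family of $k$-dimensional RS codes in $\mathbb{F}_q^\ell$ (its petals) for which there is a fixed $c$-dimensional subspace $E$ (the center) such that any two distinct members intersect exactly in $E$. A generator matrix of a $k$-dimensional code is a $k\times\ell$ matrix whose rows form a basis of the code. *)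

theory Defs
  imports
    "Jordan_Normal_Form.DL_Rank"
    "HOL-Computational_Algebra.Polynomial"
    "HOL-Number_Theory.Modular_Inverse"
begin

section \<open>Sequences and the matrix \<open>V\<close>\<close>

text \<open>A sequence in \<open>[n]\<^sup>l\<close> is a list with entries in \<open>{1..n}\<close>; only its positions are counted
  from 0.\<close>

definition sequences :: "nat \<Rightarrow> nat \<Rightarrow> nat list set" where
  "sequences n l = {I. length I = l \<and> set I \<subseteq> {1..n}}"

definition increasing :: "nat list \<Rightarrow> bool" where
  "increasing I \<longleftrightarrow> sorted_wrt (<) I"

definition agreements :: "nat \<Rightarrow> nat list \<Rightarrow> nat list \<Rightarrow> nat set" where
  "agreements l I J = {h. h < l \<and> I ! h = J ! h}"

text \<open>Columns \<open>0, \<dots>, k - 1\<close> hold the powers \<open>0, \<dots>, k - 1\<close> of \<open>\<alpha> (I ! h)\<close>, columns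
  \<open>k, \<dots>, 2 k - 2\<close> the powers \<open>1, \<dots>, k - 1\<close> of \<open>\<alpha> (J ! h)\<close>.\<close>

definition V_mat :: "nat \<Rightarrow> nat \<Rightarrow> nat list \<Rightarrow> nat list \<Rightarrow> (nat \<Rightarrow> 'a::field) \<Rightarrow> 'a mat" where
  "V_mat k l I J \<alpha> = mat l (2 * k - 1)
     (\<lambda>(h, j). if j < k then \<alpha> (I ! h) ^ j else \<alpha> (J ! h) ^ (j - (k - 1)))"


section \<open>Reed--Solomon codes and sunflowers\<close>

definition space_on :: "nat \<Rightarrow> 'a::field vec set \<Rightarrow> ('a, 'a vec) module" where
  "space_on l W = (module_vec TYPE('a) l)\<lparr>carrier := W\<rparr>"

definition is_subspace_of_dim :: "nat \<Rightarrow> nat \<Rightarrow> 'a::field vec set \<Rightarrow> bool" where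
  "is_subspace_of_dim l d W \<longleftrightarrow>
     subspace class_ring W (module_vec TYPE('a) l) \<and> vectorspace.dim class_ring (space_on l W) = d"

text \<open>\<open>degree 0 = 0\<close>, so for \<open>k > 0\<close> the zero polynomial is included.\<close>

definition RS_code :: "nat \<Rightarrow> nat \<Rightarrow> 'a::field vec \<Rightarrow> 'a vec set" where
  "RS_code l k \<beta> = {vec l (\<lambda>h. poly f (\<beta> $ h)) | f. degree f < k}"

definition is_RS_code :: "nat \<Rightarrow> nat \<Rightarrow> 'a::field vec set \<Rightarrow> bool" where
  "is_RS_code l k C \<longleftrightarrow>
     (\<exists>\<beta> \<in> carrier_vec l. inj_on (\<lambda>h. \<beta> $ h) {..<l} \<and> C = RS_code l k \<beta>)"

text \<open>The field size \<open>q\<close> is the cardinality of the type \<open>'a\<close>.\<close>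

definition RS_sunflower :: "nat \<Rightarrow> nat \<Rightarrow> nat \<Rightarrow> ('a::{field,finite}) vec set set \<Rightarrow> bool" where
  "RS_sunflower l k c \<F> \<longleftrightarrow>
     1 \<le> c \<and> c < k \<and> k \<le> l \<and> l \<le> card (UNIV :: 'a set) \<and>
     (\<forall>C\<in>\<F>. is_RS_code l k C \<and> is_subspace_of_dim l k C) \<and>
     (\<exists>E. is_subspace_of_dim l c E \<and> (\<forall>C\<in>\<F>. \<forall>D\<in>\<F>. C \<noteq> D \<longrightarrow> C \<inter> D = E))"

definition is_generator_matrix :: "nat \<Rightarrow> nat \<Rightarrow> 'a::field vec set \<Rightarrow> 'a mat \<Rightarrow> bool" where
  "is_generator_matrix l k C G \<longleftrightarrow>
     G \<in> carrier_mat k l \<and> distinct (rows G) \<and>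
     vectorspace.basis class_ring (space_on l C) (set (rows G))"


section \<open>Algorithms over \<open>\<bbbF>\<^sub>p\<close>, \<open>\<int>\<close> and \<open>\<bbbF>\<^sub>q\<close>\<close>

text \<open>
  An algorithm is a three-sorted straight-line program. There is one bank of registers for each
  of the sorts \<open>\<bbbF>\<^sub>p\<close>, \<open>\<int>\<close> and \<open>\<bbbF>\<^sub>q\<close>; every instruction appends its result to the bank of its sort,
  so nothing is ever overwritten. The instruction list, and thus the number of operations, does
  not depend on the message, which is given as the initial contents of the \<open>\<bbbF>\<^sub>p\<close> bank.
  Each instruction, loading a constant included, is one operation of the sort of its result.

  Elements of \<open>\<bbbF>\<^sub>p\<close> are the integers \<open>0, \<dots>, p - 1\<close> with arithmetic modulo \<open>p\<close>. The sorts are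
  connected by \<open>Z_Lift\<close>, which reads an element of \<open>\<bbbF>\<^sub>p\<close> as an integer, and by \<open>Q_Lookup\<close>, which
  reads \<open>\<alpha> i\<close> for an integer \<open>i\<close> in \<open>{1..n}\<close>.
\<close>

datatype ring_op = Plus | Minus | Times

datatype 'a instr =
    P_Const int | P_Op ring_op nat nat | P_Inverse nat
  | Z_Const int | Z_Op ring_op nat nat | Z_Lift nat
  | Q_Const 'a  | Q_Op ring_op nat nat | Q_Inverse nat | Q_Lookup nat

datatype op_sort = P_sort | Z_sort | Q_sort

fun sort_of :: "'a instr \<Rightarrow> op_sort" where
  "sort_of (P_Const _) = P_sort"
| "sort_of (P_Op _ _ _) = P_sort"
| "sort_of (P_Inverse _) = P_sort"
| "sort_of (Z_Const _) = Z_sort"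
| "sort_of (Z_Op _ _ _) = Z_sort"
| "sort_of (Z_Lift _) = Z_sort"
| "sort_of (Q_Const _) = Q_sort"
| "sort_of (Q_Op _ _ _) = Q_sort"
| "sort_of (Q_Inverse _) = Q_sort"
| "sort_of (Q_Lookup _) = Q_sort"

definition num_ops :: "op_sort \<Rightarrow> 'a instr list \<Rightarrow> nat" where
  "num_ops \<sigma> prog = length (filter (\<lambda>i. sort_of i = \<sigma>) prog)"

record 'a regs =
  p_regs :: "int list"
  z_regs :: "int list"
  q_regs :: "'a list"

fun eval_op :: "ring_op \<Rightarrow> 'r::ring \<Rightarrow> 'r \<Rightarrow> 'r" where
  "eval_op Plus x y = x + y"
| "eval_op Minus x y = x - y"
| "eval_op Times x y = x * y"

definition push_p :: "bool \<Rightarrow> int \<Rightarrow> 'a regs \<Rightarrow> 'a regs option" where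
  "push_p ok v s = (if ok then Some (s\<lparr>p_regs := p_regs s @ [v]\<rparr>) else None)"

definition push_z :: "bool \<Rightarrow> int \<Rightarrow> 'a regs \<Rightarrow> 'a regs option" where
  "push_z ok v s = (if ok then Some (s\<lparr>z_regs := z_regs s @ [v]\<rparr>) else None)"

definition push_q :: "bool \<Rightarrow> 'a \<Rightarrow> 'a regs \<Rightarrow> 'a regs option" where
  "push_q ok v s = (if ok then Some (s\<lparr>q_regs := q_regs s @ [v]\<rparr>) else None)"

text \<open>\<open>None\<close> is a failed execution: reading an undefined register, inverting zero, loading a
  constant outside \<open>{0..<p}\<close> as an element of \<open>\<bbbF>\<^sub>p\<close>, or looking up outside \<open>{1..n}\<close>.\<close>

fun step :: "nat \<Rightarrow> nat \<Rightarrow> (nat \<Rightarrow> 'a::field) \<Rightarrow> 'a instr \<Rightarrow> 'a regs \<Rightarrow> 'a regs option" where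
  "step n p \<alpha> (P_Const c) s = push_p (c \<in> {0..<int p}) c s"
| "step n p \<alpha> (P_Op f i j) s =
     push_p (i < length (p_regs s) \<and> j < length (p_regs s))
            (eval_op f (p_regs s ! i) (p_regs s ! j) mod int p) s"
| "step n p \<alpha> (P_Inverse i) s =
     push_p (i < length (p_regs s) \<and> p_regs s ! i \<noteq> 0) (modular_inverse (int p) (p_regs s ! i)) s"
| "step n p \<alpha> (Z_Const c) s = push_z True c s"
| "step n p \<alpha> (Z_Op f i j) s =
     push_z (i < length (z_regs s) \<and> j < length (z_regs s))
            (eval_op f (z_regs s ! i) (z_regs s ! j)) s"
| "step n p \<alpha> (Z_Lift i) s = push_z (i < length (p_regs s)) (p_regs s ! i) s"
| "step n p \<alpha> (Q_Const c) s = push_q True c s"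
| "step n p \<alpha> (Q_Op f i j) s =
     push_q (i < length (q_regs s) \<and> j < length (q_regs s))
            (eval_op f (q_regs s ! i) (q_regs s ! j)) s"
| "step n p \<alpha> (Q_Inverse i) s =
     push_q (i < length (q_regs s) \<and> q_regs s ! i \<noteq> 0) (inverse (q_regs s ! i)) s"
| "step n p \<alpha> (Q_Lookup i) s =
     push_q (i < length (z_regs s) \<and> z_regs s ! i \<in> {1..int n}) (\<alpha> (nat (z_regs s ! i))) s"

fun run :: "nat \<Rightarrow> nat \<Rightarrow> (nat \<Rightarrow> 'a::field) \<Rightarrow> 'a instr list \<Rightarrow> 'a regs \<Rightarrow> 'a regs option" where
  "run n p \<alpha> [] s = Some s"
| "run n p \<alpha> (i # prog) s = Option.bind (step n p \<alpha> i s) (run n p \<alpha> prog)"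

definition initial_regs :: "int list \<Rightarrow> 'a regs" where
  "initial_regs m = \<lparr>p_regs = m, z_regs = [], q_regs = []\<rparr>"

definition messages :: "nat \<Rightarrow> nat \<Rightarrow> int list set" where
  "messages p k = {m. length m = k \<and> set m \<subseteq> {0..<int p}}"

text \<open>The output of an algorithm is a \<open>k \<times> l\<close> matrix whose entry \<open>(i, j)\<close> is the
  \<open>\<bbbF>\<^sub>q\<close> register with number \<open>out i j\<close>. As \<open>\<int>\<close> registers are never overwritten, the final ones
  are all the integers involved.\<close>

definition outputs ::
  "nat \<Rightarrow> nat \<Rightarrow> (nat \<Rightarrow> 'a::field) \<Rightarrow> nat \<Rightarrow> nat \<Rightarrow> 'a instr list \<Rightarrow> (nat \<Rightarrow> nat \<Rightarrow> nat)
     \<Rightarrow> int list \<Rightarrow> 'a mat \<Rightarrow> bool" where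
  "outputs n p \<alpha> k l prog out m G \<longleftrightarrow>
     (\<exists>s. run n p \<alpha> prog (initial_regs m) = Some s \<and>
          (\<forall>z\<in>set (z_regs s). \<bar>z\<bar> < int n) \<and>
          (\<forall>i<k. \<forall>j<l. out i j < length (q_regs s)) \<and>
          G = mat k l (\<lambda>(i, j). q_regs s ! out i j))"

text \<open>
  An algorithm that encodes messages as petals of \<open>\<F>\<close>. Distinct messages have distinct petals;
  without this condition an algorithm that ignores its input would do.
\<close>

definition encodes_into ::
  "nat \<Rightarrow> nat \<Rightarrow> (nat \<Rightarrow> 'a::field) \<Rightarrow> nat \<Rightarrow> nat \<Rightarrow> 'a instr list \<Rightarrow> (nat \<Rightarrow> nat \<Rightarrow> nat)
     \<Rightarrow> 'a vec set set \<Rightarrow> bool" where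
  "encodes_into n p \<alpha> k l prog out \<F> \<longleftrightarrow>
     (\<exists>petal. inj_on petal (messages p k) \<and>
        (\<forall>m \<in> messages p k. petal m \<in> \<F> \<and>
           (\<exists>G. outputs n p \<alpha> k l prog out m G \<and> is_generator_matrix l k (petal m) G)))"

text \<open>
  The absolute constant behind the \<open>O\<close>-bounds. It is fixed here because a constant quantified
  existentially inside a theorem about the field type \<open>'a\<close> could depend on that type, hence on
  \<open>q\<close>, which would make such bounds void (\<open>k \<le> l \<le> q\<close>).
\<close>

definition op_factor :: nat where
  "op_factor = 4"

end

theory Submission
  imports Defs
begin

text \<open>
  A message over \<open>\<bbbF>\<^sub>p\<close> is read as a polynomial \<open>f\<close> of degree less than \<open>k\<close>, and \<open>f\<close> as the
  increasing sequence \<open>I\<^sub>f\<close> whose entry at position \<open>h\<close> is \<open>h p + f(h) + 1\<close>. The entries lie in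
  consecutive blocks of length \<open>p\<close>, so the sequence increases whatever \<open>f\<close> is, and it stays inside
  \<open>[n]\<close> because \<open>l p \<le> n\<close>. Two sequences agree at \<open>h\<close> exactly if the polynomials do, and as
  \<open>l \<le> p\<close> makes the positions distinct modulo \<open>p\<close>, distinct messages give sequences that agree on
  at most \<open>k - 1\<close> coordinates. That is where the rank hypothesis applies.

  The petal of a message is the Reed--Solomon code with evaluation points \<open>\<alpha>(I\<^sub>f(h))\<close>. A common
  codeword of the petals of \<open>I\<close> and \<open>J\<close> comes from two polynomials \<open>u\<close>, \<open>v\<close> of degree less than \<open>k\<close>
  with \<open>u(\<alpha>(I(h))) = v(\<alpha>(J(h)))\<close> for all \<open>h\<close>, that is, from a kernel vector of the matrix \<open>V\<close>: one
  column serves both constant terms, so \<open>u\<^sub>0 - v\<^sub>0\<close> is its first entry. Full column rank forces this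
  vector to be 0, so \<open>u\<close> is constant (\<open>RS_codes_meet_in_constants\<close>). Hence any two petals of distinct
  messages meet exactly in the line of constant words, and they are distinct since their dimension
  is \<open>k \<ge> 2\<close>.

  The prime comes from Bertrand's postulate between \<open>n div (2 l)\<close> and twice this number. The
  postulate is proved by Erdos's argument: without a prime in \<open>(m, 2 m]\<close> the central binomial
  coefficient would have only prime factors up to \<open>2 m / 3\<close>, and these cannot make up its size of
  at least \<open>4\<^sup>m / (2 m)\<close> once \<open>m\<close> is large; a chain of explicit primes settles the small \<open>m\<close>.

  The encoder evaluates \<open>f\<close> at all positions by Horner's rule over \<open>\<bbbF>\<^sub>p\<close>, computes the indices over
  \<open>\<int>\<close>, looks up the evaluation points, and writes down their powers: the generator matrix is the
  transposed Vandermonde matrix. All integers stay below \<open>n\<close> since \<open>l p < n\<close> holds strictly.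
\<close>

section \<open>Prime powers dividing binomial coefficients\<close>

text \<open>The numbers \<open>1 / (k (n choose k))\<close> form Leibniz's harmonic triangle, in which every entry is the
  difference of two entries of the previous column: with \<open>b(n, k) = k (n choose k)\<close>,
  \<open>1 / b(n, k + 1) = 1 / b(n - 1, k) - 1 / b(n, k)\<close>. Starting from \<open>b(n, 1) = n\<close>, all
  \<open>Lcm {1..n} / b(n, k)\<close> are therefore integers.\<close>

lemma mult_choose_dvd_Lcm:
  fixes n k :: nat
  assumes "0 < k" "k \<le> n"
  shows "k * (n choose k) dvd Lcm {1..n}"
  using assms
proof (induction k arbitrary: n)
  case 0
  then show ?case by simp
next
  case (Suc k n)
  show ?case
  proof (cases "k = 0")
    case True
    then show ?thesis using Suc.prems by (auto intro!: dvd_Lcm)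
  next
    case False
    obtain m where n: "n = Suc m" using Suc.prems by (cases n) auto
    obtain i where k: "k = Suc i" using False by (cases k) auto
    define a b c where "a = k * (n choose k)" and "b = k * (m choose k)"
      and "c = Suc k * (n choose Suc k)"
    have "a dvd Lcm {1..n}" unfolding a_def using Suc False by auto
    then obtain x where x: "Lcm {1..n} = a * x" ..
    have "b dvd Lcm {1..m}" unfolding b_def using Suc False n by auto
    also have "Lcm {1..m} dvd Lcm {1..n}" using n by (intro Lcm_subset) auto
    finally obtain y where y: "Lcm {1..n} = b * y" ..
    have a': "a = n * (m choose i)" unfolding a_def n k by (rule Suc_times_binomial)
    have c': "c = n * (m choose k)" unfolding c_def n by (rule Suc_times_binomial)
    have ab: "a = b + k * (m choose i)"
      unfolding a_def b_def n k by (simp add: algebra_simps)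
    \<comment> \<open>The harmonic triangle relation with denominators cleared.\<close>
    have leibniz: "int c * (int a - int b) = int a * int b"
    proof -
      have "int a - int b = int k * int (m choose i)" using ab by simp
      then show ?thesis unfolding a' c' b_def by simp
    qed
    have pos: "a > 0" "b > 0" unfolding a_def b_def using Suc.prems False n by auto
    have "int a * int b * (int c * (int y - int x)) = int c * (int a * (int b * int y) - int b * (int a * int x))"
      by (simp add: algebra_simps)
    also have "\<dots> = int c * (int a - int b) * int (Lcm {1..n})"
      using x y by (simp add: algebra_simps flip: of_nat_mult)
    also have "\<dots> = int a * int b * int (Lcm {1..n})" unfolding leibniz ..
    finally have "int c * (int y - int x) = int (Lcm {1..n})" using pos by simp
    then have "int c dvd int (Lcm {1..n})" by (metis dvd_triv_left)
    then show ?thesis unfolding c_def by presburger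
  qed
qed

lemma prime_power_dvd_Lcm_le:
  fixes p n e :: nat
  assumes "prime p" "n > 0" "p ^ e dvd Lcm {1..n}"
  shows "p ^ e \<le> n"
  using assms(2,3)
proof (induction n)
  case 0
  then show ?case by simp
next
  case (Suc n)
  have L: "Lcm {1..Suc n} = lcm (Suc n) (Lcm {1..n})"
    by (simp add: atLeastAtMostSuc_conv)
  have nz: "Lcm {1..n} \<noteq> 0" by (subst Lcm_0_iff) auto
  have "e \<le> multiplicity p (lcm (Suc n) (Lcm {1..n}))"
    using Suc.prems assms(1) nz unfolding L 
    by (subst (asm) power_dvd_iff_le_multiplicity) (auto simp: lcm_eq_0_iff)
  also have "\<dots> = max (multiplicity p (Suc n)) (multiplicity p (Lcm {1..n}))"
    using nz assms(1) by (intro multiplicity_lcm) auto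
  finally have "p ^ e dvd Suc n \<or> p ^ e dvd Lcm {1..n}"
    by (auto simp: le_max_iff_disj intro: multiplicity_dvd')
  then show ?case
  proof
    assume "p ^ e dvd Suc n" then show ?thesis by (intro dvd_imp_le) auto
  next
    assume *: "p ^ e dvd Lcm {1..n}"
    show ?thesis
    proof (cases "n = 0")
      case True then show ?thesis using * assms(1) by (auto simp: prime_gt_Suc_0_nat)
    next
      case False then show ?thesis using Suc.IH * by simp
    qed
  qed
qed

text \<open>This bound replaces Legendre's formula: no single prime contributes more than \<open>n\<close> to a binomial
  coefficient \<open>n choose k\<close>.\<close>

lemma prime_power_dvd_choose_le:
  fixes p n k e :: nat
  assumes "prime p" "0 < k" "k \<le> n" "p ^ e dvd n choose k"
  shows "p ^ e \<le> n"
proof (rule prime_power_dvd_Lcm_le)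
  have "p ^ e dvd k * (n choose k)" using assms(4) by (rule dvd_mult)
  also have "\<dots> dvd Lcm {1..n}" using assms by (intro mult_choose_dvd_Lcm)
  finally show "p ^ e dvd Lcm {1..n}" .
qed (use assms in auto)

section \<open>Bertrand's postulate\<close>

definition primorial :: "nat \<Rightarrow> nat" where
  "primorial n = \<Prod>{p. prime p \<and> p \<le> n}"

lemma prod_primes_dvd:
  fixes A :: "nat set"
  assumes "finite A" "\<And>p. p \<in> A \<Longrightarrow> prime p \<and> p dvd N"
  shows "\<Prod>A dvd N"
  using assms
proof (induction A rule: finite_induct)
  case (insert p A)
  have "coprime p (\<Prod>A)"
    using insert by (intro prod_coprime_right primes_coprime) auto
  then show ?case using insert by (auto intro: divides_mult)
qed simp

text \<open>The coefficient occurs twice in its row of Pascal's triangle, whose sum is \<open>2 * 4\<^sup>m\<close>.\<close>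

lemma odd_middle_choose_le: "Suc (2 * m) choose m \<le> 4 ^ m"
proof -
  have "2 * (Suc (2 * m) choose m) = (Suc (2 * m) choose m) + (Suc (2 * m) choose Suc m)"
    using binomial_symmetric[of m "Suc (2 * m)"] by (simp add: Suc_diff_le)
  also have "\<dots> = (\<Sum>k\<in>{m, Suc m}. Suc (2 * m) choose k)" by simp
  also have "\<dots> \<le> (\<Sum>k\<le>Suc (2 * m). Suc (2 * m) choose k)"
    by (intro sum_mono2) auto
  also have "\<dots> = 2 * 4 ^ m" by (simp only: choose_row_sum) (simp add: power_mult)
  finally show ?thesis by simp
qed

text \<open>For odd \<open>n = 2 m + 1\<close> the primes in \<open>(m + 1, n]\<close> all divide \<open>n choose m\<close>, since they divide \<open>n!\<close>
  but neither \<open>m!\<close> nor \<open>(m + 1)!\<close>. So they contribute at most \<open>4\<^sup>m\<close>, and the others at most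
  \<open>4\<close> to the power \<open>m + 1\<close> by induction. An even number greater than 2 adds no prime.\<close>

lemma primorial_le: "primorial n \<le> 4 ^ n"
proof (induction n rule: less_induct)
  case (less n)
  consider "n \<le> 1" | "n = 2" | "n > 2" "even n" | m where "n = Suc (2 * m)" "m \<ge> 1"
  proof (cases "even n")
    case True then show ?thesis using that by linarith
  next
    case False then obtain m where "n = Suc (2 * m)" by (auto elim: oddE)
    then show ?thesis using that by (cases "m = 0") auto
  qed
  then show ?case
  proof cases
    case 1
    then have "{p. prime p \<and> p \<le> n} = {}" by (auto dest: prime_ge_2_nat)
    then show ?thesis unfolding primorial_def by (simp only: prod.empty) simp
  next
    case 2
    then have "{p. prime p \<and> p \<le> n} = {2}" by (auto dest: prime_ge_2_nat intro: antisym)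
    then show ?thesis unfolding primorial_def using 2 by simp
  next
    case 3
    then have "\<not> prime n" using prime_odd_nat[of n] by auto
    then have "{p. prime p \<and> p \<le> n} = {p. prime p \<and> p \<le> n - 1}"
    proof (intro Collect_cong conj_cong refl)
      fix p :: nat assume "prime p"
      then have "p \<noteq> n" using \<open>\<not> prime n\<close> by auto
      then show "p \<le> n \<longleftrightarrow> p \<le> n - 1" using 3(1) by linarith
    qed
    then have "primorial n = primorial (n - 1)" unfolding primorial_def by simp
    also have "\<dots> \<le> 4 ^ (n - 1)" using 3 by (intro less) auto
    also have "\<dots> \<le> 4 ^ n" by (intro power_increasing) auto
    finally show ?thesis .
  next
    case 4
    define A where "A = {p. prime p \<and> p \<le> Suc m}"
    define B where "B = {p. prime p \<and> Suc m < p \<and> p \<le> n}"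
    have "{p. prime p \<and> p \<le> n} = A \<union> B" unfolding A_def B_def using 4 by auto
    moreover have "finite A" "finite B" "A \<inter> B = {}" unfolding A_def B_def by auto
    ultimately have split: "primorial n = \<Prod>A * \<Prod>B"
      unfolding primorial_def by (simp add: prod.union_disjoint)
    have "\<Prod>A = primorial (Suc m)" by (simp add: A_def primorial_def)
    also have "\<dots> \<le> 4 ^ Suc m" using 4 by (intro less) auto
    finally have leA: "\<Prod>A \<le> 4 ^ Suc m" .
    have "\<Prod>B dvd n choose m"
    proof (rule prod_primes_dvd)
      fix p assume p: "p \<in> B"
      then have pr: "prime p" and pl: "p \<le> n" and pg: "p > Suc m" by (auto simp: B_def)
      have "p dvd fact n" using pr pl by (simp add: prime_dvd_fact_iff)
      moreover have "fact n = fact m * fact (Suc m) * (n choose m)"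
        using binomial_fact_lemma[of m n] 4 by (simp add: Suc_diff_le)
      ultimately have "p dvd fact m * fact (Suc m) * (n choose m)" by simp
      then have "p dvd (n choose m)"
        using pr pg by (auto simp: prime_dvd_mult_iff prime_dvd_fact_iff simp del: fact_Suc)
      then show "prime p \<and> p dvd n choose m" using pr by simp
    qed fact
    then have "\<Prod>B \<le> n choose m" using 4 by (intro dvd_imp_le) auto
    also have "\<dots> \<le> 4 ^ m" using odd_middle_choose_le 4 by simp
    finally have "primorial n \<le> 4 ^ Suc m * 4 ^ m" unfolding split using leA by (intro mult_mono) auto
    also have "\<dots> = 4 ^ n" using 4 by (simp flip: power_add add: mult_2)
    finally show ?thesis .
  qed
qed

text \<open>The only multiples of \<open>p\<close> up to \<open>2 n\<close> are \<open>p\<close> and \<open>2 p\<close>, so \<open>p\<close> divides \<open>(2 n)!\<close> exactly twice;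
  both factors are used up by the two copies of \<open>n!\<close> in the denominator.\<close>

lemma not_dvd_central_binomial:
  fixes p n :: nat
  assumes p: "prime p" "p > 2" "p \<le> n" "2 * n < 3 * p"
  shows "\<not> p dvd (2 * n choose n)"
proof
  assume "p dvd (2 * n choose n)"
  moreover have "p dvd fact n" using p by (simp add: prime_dvd_fact_iff)
  ultimately have "p * p * p dvd fact n * fact n * (2 * n choose n)"
    by (intro mult_dvd_mono)
  then have dvd: "p * p * p dvd fact (2 * n)"
    using binomial_fact_lemma[of n "2 * n"] by (simp add: mult_2)
  define M where "M = \<Prod>({1..2 * n} - {p, 2 * p})"
  have "fact (2 * n) = \<Prod>{1..2 * n}" by (simp add: fact_prod)
  also have "{1..2 * n} = insert p (insert (2 * p) ({1..2 * n} - {p, 2 * p}))"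
    using p by auto
  also have "\<Prod>\<dots> = p * (2 * p * M)" unfolding M_def using p
    by (subst prod.insert; simp)+
  finally have "p * p * p dvd p * p * (2 * M)" using dvd by (simp add: mult_ac)
  then have "p dvd 2 * M"
    using p(1) prime_gt_0_nat[of p] nat_mult_dvd_cancel1[of "p * p" p "2 * M"] by simp
  moreover have "\<not> p dvd 2" using p by (auto dest: dvd_imp_le)
  ultimately have "p dvd M" using p by (simp add: prime_dvd_mult_iff)
  then obtain i where i: "i \<in> {1..2 * n} - {p, 2 * p}" "p dvd i"
    unfolding M_def using p(1) by (subst (asm) prime_dvd_prod_iff) (simp, simp, blast)
  then obtain c where c: "i = p * c" by (elim dvdE)
  have "p * c \<le> 2 * n" using i c by simp
  then have "p * c < p * 3" using p by linarith
  then have "c < 3" by simp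
  moreover have "c \<noteq> 0" "c \<noteq> 1" "c \<noteq> 2" using i c by auto
  ultimately show False by linarith
qed

text \<open>A prime factor \<open>p\<close> with \<open>p\<^sup>2 \<le> 2 n\<close> is less than \<open>s\<close> and contributes at most \<open>2 n\<close>. A larger one
  occurs only once, and it is at most \<open>2 n / 3\<close>: those above \<open>n\<close> are excluded by the assumption, those
  between \<open>2 n / 3\<close> and \<open>n\<close> do not divide. The
  product of the large prime factors is thus bounded by a primorial.\<close>

lemma central_binomial_le_if_no_prime:
  fixes n s :: nat
  assumes "n \<ge> 5" and s: "2 * n < s\<^sup>2" and none: "\<And>p. \<lbrakk>prime p; n < p\<rbrakk> \<Longrightarrow> \<not> p \<le> 2 * n"
  shows "(2 * n choose n) \<le> (2 * n) ^ (s - 1) * 4 ^ (2 * n div 3)"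
proof -
  define N where "N = (2 * n choose n)"
  have N0: "N \<noteq> 0" by (simp add: N_def)
  define A where "A = {p \<in> prime_factors N. p\<^sup>2 \<le> 2 * n}"
  define B where "B = {p \<in> prime_factors N. 2 * n < p\<^sup>2}"
  have fin: "finite A" "finite B" by (auto simp: A_def B_def)
  have power_le: "p ^ multiplicity p N \<le> 2 * n" if "p \<in> prime_factors N" for p
    using prime_power_dvd_choose_le[of p n "2 * n" "multiplicity p N"] that assms(1)
    by (auto simp: N_def multiplicity_dvd)
  have "N = (\<Prod>p\<in>prime_factors N. p ^ multiplicity p N)"
    using N0 by (simp add: prime_factorization_nat)
  also have "prime_factors N = A \<union> B" by (auto simp: A_def B_def)
  also have "(\<Prod>p\<in>A \<union> B. p ^ multiplicity p N)
      = (\<Prod>p\<in>A. p ^ multiplicity p N) * (\<Prod>p\<in>B. p ^ multiplicity p N)"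
    using fin by (intro prod.union_disjoint) (auto simp: A_def B_def)
  also have "\<dots> \<le> (2 * n) ^ (s - 1) * 4 ^ (2 * n div 3)"
  proof (rule mult_mono)
    have "(\<Prod>p\<in>A. p ^ multiplicity p N) \<le> (\<Prod>p\<in>A. 2 * n)"
      using power_le by (intro prod_mono) (auto simp: A_def)
    also have "\<dots> = (2 * n) ^ card A" by simp
    also have "card A \<le> card {1..<s}"
    proof (rule card_mono)
      show "A \<subseteq> {1..<s}"
      proof
        fix p assume "p \<in> A"
        then have "prime p" "p\<^sup>2 < s\<^sup>2" using s by (auto simp: A_def)
        then show "p \<in> {1..<s}" using power_less_imp_less_base[of p 2 s] prime_gt_0_nat[of p] by auto
      qed
    qed simp
    then have "(2 * n) ^ card A \<le> (2 * n) ^ (s - 1)"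
      using assms(1) by (intro power_increasing) auto
    finally show "(\<Prod>p\<in>A. p ^ multiplicity p N) \<le> (2 * n) ^ (s - 1)" .
  next
    have B: "prime p \<and> p \<le> 2 * n div 3 \<and> multiplicity p N = 1" if "p \<in> B" for p
    proof -
      have pr: "prime p" and dvd: "p dvd N" and big: "2 * n < p\<^sup>2" and mem: "p \<in> prime_factors N"
        using that by (auto simp: B_def)
      have "p dvd fact (2 * n)"
        using dvd binomial_fact_lemma[of n "2 * n"] unfolding N_def
        by (metis dvd_mult le_add2 mult_2)
      then have "p \<le> 2 * n" using pr by (simp add: prime_dvd_fact_iff)
      then have "p \<le> n" using none[OF pr] by linarith
      have "p > 2"
      proof (rule ccontr)
        assume "\<not> p > 2" then have "p\<^sup>2 \<le> 2\<^sup>2" by (intro power_mono) auto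
        then show False using big assms(1) by simp
      qed
      have "\<not> 2 * n < 3 * p"
        using not_dvd_central_binomial[OF pr \<open>p > 2\<close> \<open>p \<le> n\<close>] dvd by (auto simp: N_def)
      then have le: "p \<le> 2 * n div 3" by linarith
      have "multiplicity p N < 2"
      proof (rule ccontr)
        assume "\<not> multiplicity p N < 2"
        then have "p\<^sup>2 \<le> p ^ multiplicity p N" using pr prime_gt_0_nat[of p] by (intro power_increasing) auto
        then show False using power_le[OF mem] big by simp
      qed
      moreover have "multiplicity p N > 0" using mem by (simp add: prime_factors_multiplicity)
      ultimately show ?thesis using pr le by simp
    qed
    have "(\<Prod>p\<in>B. p ^ multiplicity p N) = \<Prod>B" using B by (intro prod.cong) auto
    also have "\<dots> \<le> primorial (2 * n div 3)" unfolding primorial_def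
      using B by (intro dvd_imp_le prod_dvd_prod_subset prod_pos) (auto dest: prime_gt_0_nat)
    also have "\<dots> \<le> 4 ^ (2 * n div 3)" by (rule primorial_le)
    finally show "(\<Prod>p\<in>B. p ^ multiplicity p N) \<le> 4 ^ (2 * n div 3)" .
  qed auto
  finally show ?thesis unfolding N_def .
qed

text \<open>If \<open>4\<^sup>j \<le> 2 n < 4 * 4\<^sup>j\<close>, comparing the upper bound with \<open>4\<^sup>n / (2 n)\<close> gives
  \<open>n / 3 \<le> (j + 1) 2 * 2\<^sup>j\<close> and hence \<open>2\<^sup>j \<le> 12 (j + 1)\<close>, which fails from \<open>j = 7\<close> on. The threshold
  is \<open>4\<^sup>7 / 2 = 8192\<close>.\<close>

lemma bertrand_large:
  fixes n :: nat
  assumes "n \<ge> 8192"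
  shows "\<exists>p. prime p \<and> n < p \<and> p \<le> 2 * n"
proof (rule ccontr)
  assume none: "\<not> ?thesis"
  obtain j where j: "4 ^ j \<le> 2 * n" "2 * n < 4 ^ Suc j"
    using ex_power_ivl1[of 4 "2 * n"] assms by auto
  define s :: nat where "s = 2 ^ Suc j"
  have s2: "s\<^sup>2 = 4 ^ Suc j" unfolding s_def by (simp add: power2_eq_square flip: power_mult_distrib)
  have s0: "s > 0" by (simp add: s_def)
  have "real (4 ^ n) \<le> real (2 * n * (2 * n choose n))"
    using central_binomial_lower_bound[of n] assms by (simp add: field_simps)
  then have "4 ^ n \<le> 2 * n * (2 * n choose n)" by linarith
  also have "\<dots> \<le> 2 * n * ((2 * n) ^ (s - 1) * 4 ^ (2 * n div 3))"
    using none assms j s2 by (intro mult_left_mono central_binomial_le_if_no_prime) auto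
  also have "\<dots> = (2 * n) ^ s * 4 ^ (2 * n div 3)"
    using s0 by (cases s) auto
  also have "\<dots> \<le> (4 ^ Suc j) ^ s * 4 ^ (2 * n div 3)"
    using j by (intro mult_right_mono power_mono) auto
  also have "\<dots> = 4 ^ (Suc j * s + 2 * n div 3)" by (simp add: power_add power_mult)
  finally have "n \<le> Suc j * s + 2 * n div 3" by (subst (asm) power_increasing_iff) auto
  then have "2 * n \<le> 6 * (Suc j * s)" by linarith
  then have "(2::nat) ^ j * 2 ^ j \<le> 2 ^ j * (12 * Suc j)"
    using order.trans[OF j(1)] unfolding s_def
    by (simp add: algebra_simps flip: power_mult_distrib)
  then have upper: "(2::nat) ^ j \<le> 12 * Suc j" by simp
  have "(4::nat) ^ 7 < 4 ^ Suc j" using j assms by simp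
  then have "j \<ge> 7" by (subst (asm) power_strict_increasing_iff) auto
  then have "(2::nat) ^ j > 12 * Suc j" by (induction j rule: dec_induct) auto
  with upper show False by simp
qed

text \<open>The candidates are given as a list so that rewriting can test them one by one.\<close>

lemma prime_nat_by_trial_division:
  fixes n s :: nat
  assumes "1 < n" "n < s\<^sup>2" "\<forall>d\<in>set [2..<s]. n mod d \<noteq> 0"
  shows "prime n"
proof (rule ccontr)
  assume "\<not> prime n"
  obtain a where a: "prime a" "a dvd n" using prime_factor_nat[of n] assms(1) by auto
  then obtain b where n: "n = a * b" by (elim dvdE)
  have "b \<noteq> 0" "b \<noteq> 1" using a(1) n assms(1) \<open>\<not> prime n\<close> by auto
  then have ab: "1 < a" "1 < b" using prime_gt_1_nat[OF a(1)] by auto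
  have no_divisor: "s \<le> d" if "d dvd n" "1 < d" for d
  proof (rule ccontr)
    assume "\<not> s \<le> d"
    then have "d \<in> set [2..<s]" using that by auto
    with assms(3) that(1) show False by (metis dvd_eq_mod_eq_0)
  qed
  have "s * s \<le> a * b" using ab n by (intro mult_le_mono no_divisor) auto
  with assms(2) n show False by (simp add: power2_eq_square)
qed

text \<open>Below the threshold it suffices to list primes each of which is at most twice its predecessor.\<close>

lemma bertrand_chain:
  fixes m n :: nat
  assumes "\<forall>p\<in>set ps. prime p" "successively (\<lambda>p q. q \<le> 2 * p) (m # ps)"
    and "m \<le> n" "n < last (m # ps)"
  shows "\<exists>p. prime p \<and> n < p \<and> p \<le> 2 * n"
  using assms
proof (induction ps arbitrary: m)
  case Nil
  then show ?case by simp
next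
  case (Cons q ps)
  show ?case
  proof (cases "n < q")
    case True
    have "q \<le> 2 * m" using Cons.prems by simp
    then show ?thesis using Cons.prems True by (intro exI[of _ q]) auto
  next
    case False
    show ?thesis by (rule Cons.IH[of q]) (use Cons.prems False in auto)
  qed
qed

theorem bertrand:
  fixes n :: nat
  assumes "n > 0"
  shows "\<exists>p. prime p \<and> n < p \<and> p \<le> 2 * n"
proof (cases "n \<ge> 8192")
  case True
  then show ?thesis by (rule bertrand_large)
next
  case False
  define ps :: "nat list" where
    "ps = [2, 3, 5, 7, 13, 23, 43, 83, 163, 317, 631, 1259, 2503, 4001, 7993, 8209]"
  have small: "prime (2::nat)" "prime (3::nat)" "prime (5::nat)" "prime (7::nat)"
    "prime (13::nat)" "prime (23::nat)" "prime (43::nat)" "prime (83::nat)"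
    by simp_all
  have p163: "prime (163::nat)"
    by (rule prime_nat_by_trial_division[where s = 13]) (simp_all add: upt_conv_Cons)
  have p317: "prime (317::nat)"
    by (rule prime_nat_by_trial_division[where s = 18]) (simp_all add: upt_conv_Cons)
  have p631: "prime (631::nat)"
    by (rule prime_nat_by_trial_division[where s = 26]) (simp_all add: upt_conv_Cons)
  have p1259: "prime (1259::nat)"
    by (rule prime_nat_by_trial_division[where s = 36]) (simp_all add: upt_conv_Cons)
  have p2503: "prime (2503::nat)"
    by (rule prime_nat_by_trial_division[where s = 51]) (simp_all add: upt_conv_Cons)
  have p4001: "prime (4001::nat)"
    by (rule prime_nat_by_trial_division[where s = 64]) (simp_all add: upt_conv_Cons)
  have p7993: "prime (7993::nat)"
    by (rule prime_nat_by_trial_division[where s = 90]) (simp_all add: upt_conv_Cons)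
  have p8209: "prime (8209::nat)"
    by (rule prime_nat_by_trial_division[where s = 91]) (simp_all add: upt_conv_Cons)
  have "\<forall>p\<in>set ps. prime p" unfolding ps_def
    using small p163 p317 p631 p1259 p2503 p4001 p7993 p8209
    by (simp only: list.set ball_simps simp_thms)
  then show ?thesis
    by (rule bertrand_chain[where m = 1]) (use False assms in \<open>auto simp: ps_def\<close>)
qed

text \<open>For \<open>m = n div (2 l)\<close> the postulate yields \<open>m < p \<le> 2 m\<close>. Here \<open>p = 2 m\<close> is impossible because
  \<open>m \<ge> l \<ge> 2\<close>, which makes the second inequality strict: this is what keeps the largest index
  \<open>l p\<close> below \<open>n\<close>.\<close>

lemma prime_between_n_div_2l_and_n_div_l:
  fixes l n :: nat
  assumes "l \<ge> 2" "n > 2 * l\<^sup>2"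
  shows "\<exists>p. prime p \<and> n \<le> 2 * l * p \<and> l * p < n \<and> l \<le> p"
proof -
  define m where "m = n div (2 * l)"
  have "2 * l * l \<le> n" using assms(2) by (simp add: power2_eq_square)
  then have "l \<le> m" unfolding m_def using assms(1) by (simp add: less_eq_div_iff_mult_less_eq mult_ac)
  then obtain p where p: "prime p" "m < p" "p \<le> 2 * m" using bertrand[of m] assms(1) by auto
  have "p \<noteq> 2 * m" using p(1) assms(1) \<open>l \<le> m\<close> prime_product[of 2 m] by auto
  then have "p < 2 * m" using p by simp
  then have "l * p < l * (2 * m)" using assms(1) by simp
  also have "\<dots> = m * (2 * l)" by simp
  also have "\<dots> \<le> n" unfolding m_def by simp
  finally have "l * p < n" .
  moreover have "n < 2 * l * Suc m"
    using mult_div_mod_eq[of "2 * l" n] mod_less_divisor[of "2 * l" n] assms(1)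
    unfolding m_def mult_Suc_right by linarith
  then have "n \<le> 2 * l * p" using p(2) by (meson Suc_leI le_trans less_imp_le mult_le_mono2)
  ultimately show ?thesis using p \<open>l \<le> m\<close> by auto
qed

section \<open>Matrices with trivial kernel\<close>

context vec_space begin

text \<open>The rank only sees the set of columns, so a repeated column would already lower it; the columns
  are therefore distinct, and then full rank is linear independence.\<close>

lemma full_rank_imp_trivial_kernel:
  assumes A: "A \<in> carrier_mat n nc" and rk: "rank A = nc"
    and v: "v \<in> carrier_vec nc" "A *\<^sub>v v = 0\<^sub>v n"
  shows "v = 0\<^sub>v nc"
proof -
  obtain S where S: "maximal S (\<lambda>T. T \<subseteq> set (cols A) \<and> lin_indpt T)"
    using maximal_exists[of "\<lambda>T. T \<subseteq> set (cols A) \<and> lin_indpt T" "card (set (cols A))" "{}"]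
    by (meson List.finite_set card_mono empty_iff empty_subsetI finite_lin_indpt2 rev_finite_subset)
  then have "card S \<le> card (set (cols A))" by (intro card_mono) (auto simp: maximal_def)
  then have "length (cols A) \<le> card (set (cols A))"
    using rank_card_indpt[OF A S] rk A by simp
  then have dist: "distinct (cols A)" by (meson card_distinct card_length le_antisym)
  have "lin_indpt (set (cols A))" by (rule full_rank_lin_indpt[OF A rk dist])
  then show ?thesis using lin_depI[OF A v(1) _ v(2) dist] by blast
qed

lemma trivial_kernel_imp_distinct_indpt_cols:
  assumes A: "A \<in> carrier_mat n nc"
    and ker: "\<And>v. v \<in> carrier_vec nc \<Longrightarrow> A *\<^sub>v v = 0\<^sub>v n \<Longrightarrow> v = 0\<^sub>v nc"
  shows "distinct (cols A)" "lin_indpt (set (cols A))"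
proof -
  show dist: "distinct (cols A)"
  proof (rule ccontr)
    assume "\<not> distinct (cols A)"
    then obtain i j where ij: "i < nc" "j < nc" "i \<noteq> j" "col A i = col A j"
      using A by (auto simp: distinct_conv_nth)
    have "A *\<^sub>v (unit_vec nc i - unit_vec nc j) = A *\<^sub>v unit_vec nc i - A *\<^sub>v unit_vec nc j"
      by (rule mult_minus_distrib_mat_vec[OF A]) auto
    also have "\<dots> = col A i - col A j"
      using A ij(1,2) col_mult2[of A n nc "1\<^sub>m nc" nc i] col_mult2[of A n nc "1\<^sub>m nc" nc j] by simp
    also have "\<dots> = 0\<^sub>v n" using A ij by auto
    finally have "(unit_vec nc i - unit_vec nc j :: 'a vec) = 0\<^sub>v nc" by (rule ker[rotated]) simp
    then have "(unit_vec nc i - unit_vec nc j :: 'a vec) $ i = 0" using ij by simp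
    then show False using ij by simp
  qed
  show "lin_indpt (set (cols A))"
  proof
    assume "lin_dep (set (cols A))"
    then obtain v where "v \<in> carrier_vec nc" "v \<noteq> 0\<^sub>v nc" "A *\<^sub>v v = 0\<^sub>v n"
      using lin_depE[OF A _ dist] by blast
    with ker show False by blast
  qed
qed

lemma span_indpt_basis_dim:
  assumes S: "finite S" "S \<subseteq> carrier_vec n" "lin_indpt S"
  shows "subspace class_ring (span S) V"
    and "vectorspace.basis class_ring (vs (span S)) S"
    and "vectorspace.dim class_ring (vs (span S)) = card S"
proof -
  have sub: "submodule class_ring (span S) V" using S by (intro span_is_submodule) simp
  show "subspace class_ring (span S) V" using S by (intro span_is_subspace) simp
  then have vs: "vectorspace class_ring (vs (span S))" by (rule subspace_is_vs)
  have inc: "S \<subseteq> span S" using S by (intro in_own_span) simp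
  note nd = span_li_not_depend[OF inc sub]
  show b: "vectorspace.basis class_ring (vs (span S)) S"
    unfolding vectorspace.basis_def[OF vs] using nd S inc by simp
  show "vectorspace.dim class_ring (vs (span S)) = card S"
    by (rule vectorspace.dim_basis[OF vs S(1) b])
qed

end

text \<open>Both the petals and the center arise as images of injective matrices; the columns of such a
  matrix are a basis of the image, which gives dimension and generator matrix at once.\<close>

lemma image_of_injective_mat:
  fixes A :: "'a::field mat"
  assumes A: "A \<in> carrier_mat l d"
    and ker: "\<And>v. v \<in> carrier_vec d \<Longrightarrow> A *\<^sub>v v = 0\<^sub>v l \<Longrightarrow> v = 0\<^sub>v d"
    and W: "W = {A *\<^sub>v v | v. v \<in> carrier_vec d}"
  shows "is_subspace_of_dim l d W" and "is_generator_matrix l d W (transpose_mat A)"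
proof -
  interpret vec_space "TYPE('a)" l .
  note ind = trivial_kernel_imp_distinct_indpt_cols[OF A ker]
  have carr: "set (cols A) \<subseteq> carrier_vec l" using A cols_dim by blast
  have "col_space A = W" unfolding col_space_eq[OF A] W using A by (auto intro!: mult_mat_vec_carrier)
  then have sp: "span (set (cols A)) = W" by (simp add: col_space_def)
  have eq: "space_on l W = vs W" by (simp add: space_on_def)
  note bd = span_indpt_basis_dim[OF _ carr ind(2), simplified sp, OF finite_set]
  have "card (set (cols A)) = d" using ind(1) A by (simp add: distinct_card)
  then show "is_subspace_of_dim l d W"
    unfolding is_subspace_of_dim_def eq using bd by simp
  show "is_generator_matrix l d W (transpose_mat A)"
    unfolding is_generator_matrix_def eq using bd ind(1) A by simp
qed

section \<open>Reed--Solomon codes and their intersections\<close>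

definition vandermonde :: "nat \<Rightarrow> nat \<Rightarrow> 'a::field vec \<Rightarrow> 'a mat" where
  "vandermonde l k \<beta> = mat l k (\<lambda>(h, i). \<beta> $ h ^ i)"

lemma poly_eq_sum_less:
  fixes f :: "'a::field poly"
  assumes "degree f < k"
  shows "poly f x = (\<Sum>i<k. coeff f i * x ^ i)"
proof -
  have "(\<Sum>i\<le>degree f. coeff f i * x ^ i) = (\<Sum>i<k. coeff f i * x ^ i)"
    using assms by (intro sum.mono_neutral_left) (auto simp: coeff_eq_0)
  then show ?thesis by (simp add: poly_altdef)
qed

lemma degree_less_poly_of_coeffs:
  fixes c :: "nat \<Rightarrow> 'a::comm_semiring_1"
  assumes "k > 0"
  obtains f where "degree f < k" "\<And>i. i < k \<Longrightarrow> coeff f i = c i"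
proof
  let ?f = "\<Sum>i<k. monom (c i) i"
  have co: "coeff ?f j = (if j < k then c j else 0)" for j
    by (simp add: coeff_sum if_distrib sum.delta cong: if_cong)
  have "degree ?f \<le> k - 1" using assms by (intro degree_le) (auto simp: co)
  then show "degree ?f < k" using assms by linarith
  show "coeff ?f i = c i" if "i < k" for i using that by (simp add: co)
qed

lemma vandermonde_mult_vec:
  assumes "degree f < k"
  shows "vandermonde l k \<beta> *\<^sub>v vec k (coeff f) = vec l (\<lambda>h. poly f (\<beta> $ h))"
  by (rule eq_vecI)
    (auto simp: vandermonde_def scalar_prod_def poly_eq_sum_less[OF assms] lessThan_atLeast0 mult.commute)

lemma RS_code_eq_image:
  assumes "k > 0"
  shows "RS_code l k \<beta> = {vandermonde l k \<beta> *\<^sub>v v | v. v \<in> carrier_vec k}"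
proof (intro equalityI subsetI)
  fix x assume "x \<in> RS_code l k \<beta>"
  then obtain f where "degree f < k" "x = vec l (\<lambda>h. poly f (\<beta> $ h))" by (auto simp: RS_code_def)
  then have "x = vandermonde l k \<beta> *\<^sub>v vec k (coeff f)" by (simp add: vandermonde_mult_vec)
  then show "x \<in> {vandermonde l k \<beta> *\<^sub>v v | v. v \<in> carrier_vec k}" by auto
next
  fix x assume "x \<in> {vandermonde l k \<beta> *\<^sub>v v | v. v \<in> carrier_vec k}"
  then obtain v where v: "v \<in> carrier_vec k" "x = vandermonde l k \<beta> *\<^sub>v v" by auto
  obtain f where f: "degree f < k" "\<And>i. i < k \<Longrightarrow> coeff f i = v $ i"
    using degree_less_poly_of_coeffs[OF assms, of "\<lambda>i. v $ i"] by auto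
  have "v = vec k (coeff f)" using v f by (intro eq_vecI) auto
  then show "x \<in> RS_code l k \<beta>" using v f vandermonde_mult_vec[of f k l \<beta>] by (auto simp: RS_code_def)
qed

text \<open>A kernel vector is the coefficient vector of a polynomial of degree less than \<open>k\<close> with the
  \<open>l \<ge> k\<close> distinct roots \<open>\<beta> $ h\<close>.\<close>

lemma vandermonde_trivial_kernel:
  assumes inj: "inj_on (\<lambda>h. \<beta> $ h) {..<l}" and "0 < k" "k \<le> l"
    and v: "v \<in> carrier_vec k" "vandermonde l k \<beta> *\<^sub>v v = 0\<^sub>v l"
  shows "v = 0\<^sub>v k"
proof -
  obtain f where f: "degree f < k" "\<And>i. i < k \<Longrightarrow> coeff f i = v $ i"
    using degree_less_poly_of_coeffs[OF assms(2), of "\<lambda>i. v $ i"] by auto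
  have veq: "v = vec k (coeff f)" using v f by (intro eq_vecI) auto
  then have "vec l (\<lambda>h. poly f (\<beta> $ h)) = 0\<^sub>v l" using v vandermonde_mult_vec[OF f(1), of l \<beta>] by simp
  then have root: "poly f (\<beta> $ h) = 0" if "h < l" for h using that by (metis index_vec index_zero_vec(1))
  have "f = 0"
  proof (rule ccontr)
    assume "f \<noteq> 0"
    have "l = card ((\<lambda>h. \<beta> $ h) ` {..<l})" using inj by (simp add: card_image)
    also have "\<dots> \<le> card {x. poly f x = 0}"
      using root by (intro card_mono poly_roots_finite[OF \<open>f \<noteq> 0\<close>]) auto
    also have "\<dots> \<le> degree f" by (rule card_poly_roots_bound[OF \<open>f \<noteq> 0\<close>])
    finally show False using f assms by simp
  qed
  then show ?thesis using veq by auto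
qed

lemma RS_code_dim_and_generator:
  assumes "inj_on (\<lambda>h. \<beta> $ h) {..<l}" "0 < k" "k \<le> l"
  shows "is_subspace_of_dim l k (RS_code l k \<beta>)"
    and "is_generator_matrix l k (RS_code l k \<beta>) (transpose_mat (vandermonde l k \<beta>))"
proof -
  have A: "vandermonde l k \<beta> \<in> carrier_mat l k" by (simp add: vandermonde_def)
  note * = image_of_injective_mat[OF A vandermonde_trivial_kernel[OF assms] RS_code_eq_image[OF assms(2)]]
  show "is_subspace_of_dim l k (RS_code l k \<beta>)" by (rule *(1))
  show "is_generator_matrix l k (RS_code l k \<beta>) (transpose_mat (vandermonde l k \<beta>))" by (rule *(2))
qed

text \<open>The center of the sunflower is itself a Reed--Solomon code, of dimension 1, whatever the
  evaluation points are.\<close>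

lemma RS_code_1:
  fixes \<beta> :: "'a::field vec"
  shows "RS_code l 1 \<beta> = {vec l (\<lambda>_. c) | c. True}"
proof (intro equalityI subsetI)
  fix x assume "x \<in> RS_code l 1 \<beta>"
  then obtain f where f: "degree f = 0" "x = vec l (\<lambda>h. poly f (\<beta> $ h))" by (auto simp: RS_code_def)
  obtain c where "f = [:c:]" using f(1) by (rule degree_eq_zeroE)
  then show "x \<in> {vec l (\<lambda>_. c) | c. True}" using f(2) by auto
next
  fix x assume "x \<in> {vec l (\<lambda>_. c :: 'a) | c. True}"
  then obtain c where c: "x = vec l (\<lambda>_. c)" by auto
  then show "x \<in> RS_code l 1 \<beta>" unfolding RS_code_def by (auto intro!: exI[of _ "[:c:]"])
qed

text \<open>If \<open>f\<close> and \<open>g\<close> yield the same codeword, then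
  \<open>(f\<^sub>0 - g\<^sub>0, f\<^sub>1, \<dots>, - g\<^sub>1, \<dots>)\<close> is in the kernel of \<open>V\<close>, hence 0, and \<open>f\<close> is constant.\<close>

lemma RS_codes_meet_in_constants:
  fixes \<alpha> :: "nat \<Rightarrow> 'a::field"
  assumes k: "k > 0"
    and rank: "vec_space.rank l (V_mat k l I J \<alpha>) = 2 * k - 1"
    and \<beta>: "\<And>h. h < l \<Longrightarrow> \<beta> $ h = \<alpha> (I ! h)" and \<gamma>: "\<And>h. h < l \<Longrightarrow> \<gamma> $ h = \<alpha> (J ! h)"
  shows "RS_code l k \<beta> \<inter> RS_code l k \<gamma> = {vec l (\<lambda>_. c) | c. True}"
proof (intro equalityI subsetI)
  fix x assume "x \<in> {vec l (\<lambda>_. c :: 'a) | c. True}"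
  then obtain c where c: "x = vec l (\<lambda>_. c)" by auto
  have "x \<in> RS_code l k b" for b unfolding RS_code_def c using k by (auto intro!: exI[of _ "[:c:]"])
  then show "x \<in> RS_code l k \<beta> \<inter> RS_code l k \<gamma>" by simp
next
  fix x assume "x \<in> RS_code l k \<beta> \<inter> RS_code l k \<gamma>"
  then obtain f g where f: "degree f < k" "x = vec l (\<lambda>h. poly f (\<beta> $ h))"
    and g: "degree g < k" "x = vec l (\<lambda>h. poly g (\<gamma> $ h))" by (auto simp: RS_code_def)
  define v where "v = vec (2 * k - 1) (\<lambda>j. if j = 0 then coeff f 0 - coeff g 0
    else if j < k then coeff f j else - coeff g (j - (k - 1)))"
  have "V_mat k l I J \<alpha> *\<^sub>v v = 0\<^sub>v l"
  proof (rule eq_vecI)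
    fix h assume "h < dim_vec (0\<^sub>v l :: 'a vec)"
    then have h: "h < l" by simp
    let ?a = "\<alpha> (I ! h)" and ?b = "\<alpha> (J ! h)"
    let ?t = "\<lambda>j. (if j < k then ?a ^ j else ?b ^ (j - (k - 1))) *
      (if j = 0 then coeff f 0 - coeff g 0
        else if j < k then coeff f j else - coeff g (j - (k - 1)))"
    obtain k' where k': "k = Suc k'" using k by (cases k) auto
    have "(V_mat k l I J \<alpha> *\<^sub>v v) $ h = (\<Sum>j<2 * k - 1. ?t j)"
      using h by (simp add: V_mat_def v_def scalar_prod_def lessThan_atLeast0)
    also have "\<dots> = (\<Sum>j<k + k'. ?t j)" by (simp add: k' mult_2)
    \<comment> \<open>The columns from \<open>k\<close> on hold the powers \<open>1, \<dots>, k'\<close> of the second point.\<close>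
    also have "\<dots> = (\<Sum>j<k. ?t j) + (\<Sum>j<k'. ?t (k + j))"
      by (induction k') auto
    also have "(\<Sum>j<k'. ?t (k + j)) = - (\<Sum>j<k'. coeff g (Suc j) * ?b ^ Suc j)"
      unfolding sum_negf[symmetric] by (intro sum.cong) (auto simp: k' mult.commute)
    also have "\<dots> = coeff g 0 - poly g ?b"
      unfolding poly_eq_sum_less[OF g(1)] k' sum.lessThan_Suc_shift by simp
    also have "(\<Sum>j<k. ?t j) = (\<Sum>j<k. coeff f j * ?a ^ j) - coeff g 0"
      unfolding k' sum.lessThan_Suc_shift by (simp add: mult.commute)
    also have "\<dots> = poly f ?a - coeff g 0" by (simp add: poly_eq_sum_less[OF f(1)])
    also have "poly f ?a = poly g ?b"
      using f(2) g(2) h \<beta> \<gamma> by (metis index_vec)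
    finally show "(V_mat k l I J \<alpha> *\<^sub>v v) $ h = 0\<^sub>v l $ h" using h by simp
  qed (simp add: V_mat_def)
  then have v0: "v = 0\<^sub>v (2 * k - 1)"
    by (intro vec_space.full_rank_imp_trivial_kernel[OF _ rank]) (auto simp: V_mat_def v_def)
  have "coeff f j = 0" if "j > 0" for j
  proof (cases "j < k")
    case True
    then have "v $ j = coeff f j" using that by (simp add: v_def)
    then show ?thesis using v0 True that by simp
  next
    case False
    then show ?thesis using f by (simp add: coeff_eq_0)
  qed
  then have "degree f = 0" by (metis leading_coeff_0_iff neq0_conv degree_0)
  then obtain c where "f = [:c:]" by (auto elim: degree_eq_zeroE)
  then show "x \<in> {vec l (\<lambda>_. c) | c. True}" using f by auto
qed

section \<open>Messages as increasing sequences\<close>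

text \<open>Lagrange's theorem: modulo a prime, a polynomial with more roots than its degree vanishes. For a
  root \<open>a\<close> write \<open>f = (x - a) g + f(a)\<close> over the integers, and every other root of \<open>f\<close> modulo \<open>p\<close>
  is one of \<open>g\<close>.\<close>

lemma prime_dvd_coeffs_of_many_roots:
  fixes f :: "int poly" and p :: int
  assumes "prime p" "S \<subseteq> {0..<p}" "\<And>x. x \<in> S \<Longrightarrow> p dvd poly f x" "degree f < card S"
  shows "[:p:] dvd f"
  using assms(2-)
proof (induction "degree f" arbitrary: f S)
  case 0
  then obtain c where c: "f = [:c:]" by (metis degree_eq_zeroE)
  obtain x where "x \<in> S" using 0 by fastforce
  then show ?case using 0(3)[of x] c by simp
next
  case (Suc d)
  have "finite S" using Suc.prems(1) finite_subset by blast
  obtain a where a: "a \<in> S" using Suc.prems by fastforce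
  define g where "g = synthetic_div f a"
  have f: "f = [:- a, 1:] * g + [:poly f a:]"
    unfolding g_def by (rule synthetic_div_correct'[symmetric])
  have deg: "degree g = d" unfolding g_def degree_synthetic_div using Suc.hyps(2) by simp
  have "[:p:] dvd g"
  proof (rule Suc.hyps(1))
    show "d = degree g" by (simp add: deg)
    show "S - {a} \<subseteq> {0..<p}" using Suc.prems(1) by blast
    show "degree g < card (S - {a})"
      using a \<open>finite S\<close> Suc.prems(3) Suc.hyps(2) deg by simp
    fix x assume x: "x \<in> S - {a}"
    have "poly f x = (x - a) * poly g x + poly f a" by (subst f) (simp add: algebra_simps)
    then have "(x - a) * poly g x = poly f x - poly f a" by simp
    then have "p dvd (x - a) * poly g x" using Suc.prems(2) x a by simp
    moreover have "\<not> p dvd x - a"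
    proof
      assume "p dvd x - a"
      have "x \<in> {0..<p}" "a \<in> {0..<p}" using Suc.prems(1) x a by blast+
      then have "\<bar>x - a\<bar> < p" by auto
      with \<open>p dvd x - a\<close> have "x - a = 0"
        using dvd_imp_le_int[of "x - a" p] by fastforce
      then show False using x by simp
    qed
    ultimately show "p dvd poly g x" using assms(1) prime_dvd_mult_iff by blast
  qed
  moreover have "[:p:] dvd [:poly f a:]" using Suc.prems(2)[OF a] by simp
  ultimately show ?case by (subst f) (intro dvd_add dvd_mult)
qed

text \<open>The \<open>j\<close>-th intermediate result of Horner's rule at \<open>h\<close>. The two reductions modulo \<open>p\<close> are those
  that a program over \<open>\<bbbF>\<^sub>p\<close> makes, a multiplication followed by an addition. The leading coefficient
  is \<open>m ! 0\<close>.\<close>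

primrec horner :: "nat \<Rightarrow> int list \<Rightarrow> nat \<Rightarrow> nat \<Rightarrow> int" where
  "horner p m h 0 = 0"
| "horner p m h (Suc j) = (horner p m h j * int h mod int p + m ! j) mod int p"

lemma horner_bounds:
  assumes "p > 0"
  shows "0 \<le> horner p m h j" "horner p m h j < int p"
  using assms by (cases j; simp)+

lemma horner_eq_poly:
  assumes "j \<le> length m"
  shows "horner p m h j = poly (Poly (rev (take j m))) (int h) mod int p"
  using assms
proof (induction j)
  case (Suc j)
  then show ?case
    by (simp add: take_Suc_conv_app_nth mod_simps algebra_simps)
qed simp

text \<open>Agreements of two messages are roots modulo \<open>p\<close> of the difference of their polynomials. If there
  were \<open>k\<close> of them, \<open>p\<close> would divide all its coefficients, which are less than \<open>p\<close> in absolute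
  value and therefore 0.\<close>

lemma card_horner_agreements_less:
  assumes p: "prime p" "l \<le> p" and k: "k > 0"
    and m: "m \<in> messages p k" "m' \<in> messages p k" "m \<noteq> m'"
  shows "card {h. h < l \<and> horner p m h k = horner p m' h k} < k"
proof (rule ccontr)
  let ?A = "{h. h < l \<and> horner p m h k = horner p m' h k}"
  assume "\<not> card ?A < k"
  have len: "length m = k" "length m' = k" using m by (auto simp: messages_def)
  define f where "f = Poly (rev m) - Poly (rev m')"
  have coeff_f: "coeff f i = (if i < k then rev m ! i - rev m' ! i else 0)" for i
    using len by (simp add: f_def nth_default_def)
  then have "degree f \<le> k - 1" using k by (intro degree_le) auto
  moreover have "card (int ` ?A) = card ?A" by (intro card_image) simp
  ultimately have deg: "degree f < card (int ` ?A)" using \<open>\<not> card ?A < k\<close> k by linarith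
  have "[:int p:] dvd f"
  proof (rule prime_dvd_coeffs_of_many_roots[OF _ _ _ deg])
    fix x assume "x \<in> int ` ?A"
    then obtain h where h: "x = int h" "horner p m h k = horner p m' h k" by auto
    then have "poly (Poly (rev m)) x mod int p = poly (Poly (rev m')) x mod int p"
      using len by (simp add: horner_eq_poly)
    then show "int p dvd poly f x" unfolding f_def by (simp add: mod_eq_dvd_iff)
  qed (use p in auto)
  then have dvd: "int p dvd coeff f i" for i by (simp add: const_poly_dvd_iff)
  have "rev m ! i = rev m' ! i" if "i < k" for i
  proof -
    have "rev m ! i \<in> set m" "rev m' ! i \<in> set m'" using that len by (metis length_rev nth_mem set_rev)+
    then have b: "rev m ! i \<in> {0..<int p}" "rev m' ! i \<in> {0..<int p}" using m by (auto simp: messages_def)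
    have "int p dvd rev m ! i - rev m' ! i"
      using dvd[of i] that by (simp add: coeff_f)
    then have "(rev m ! i) mod int p = (rev m' ! i) mod int p" by (simp add: mod_eq_dvd_iff)
    then show ?thesis using b by simp
  qed
  then have "rev m = rev m'" using len by (intro nth_equalityI) auto
  then show False using m by simp
qed

text \<open>Entry \<open>h\<close> of the sequence of a message lies in block \<open>h\<close> of \<open>{1..l p}\<close>, cut into
  blocks of length \<open>p\<close> counted from 0; its offset there is the value of the message polynomial at \<open>h\<close>.\<close>

definition msg_index :: "nat \<Rightarrow> nat \<Rightarrow> int list \<Rightarrow> nat \<Rightarrow> nat" where
  "msg_index p k m h = h * p + nat (horner p m h k) + 1"

definition msg_seq :: "nat \<Rightarrow> nat \<Rightarrow> nat \<Rightarrow> int list \<Rightarrow> nat list" where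
  "msg_seq p k l m = map (msg_index p k m) [0..<l]"

lemma msg_index_bounds:
  assumes "p > 0"
  shows "h * p < msg_index p k m h" "msg_index p k m h \<le> Suc h * p"
  using horner_bounds[OF assms, of m h k] unfolding msg_index_def by auto

lemma msg_seq_props:
  assumes "p > 0" "l * p \<le> n"
  shows "msg_seq p k l m \<in> sequences n l" "increasing (msg_seq p k l m)"
    and "h < l \<Longrightarrow> msg_seq p k l m ! h = msg_index p k m h"
proof -
  show nth: "h < l \<Longrightarrow> msg_seq p k l m ! h = msg_index p k m h" for h
    by (simp add: msg_seq_def)
  have "msg_index p k m h \<in> {1..n}" if "h < l" for h
  proof -
    have "Suc h * p \<le> l * p" using that by (intro mult_le_mono) auto
    then show ?thesis using msg_index_bounds[OF assms(1), where h = h and k = k and m = m] assms(2) by simp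
  qed
  then show "msg_seq p k l m \<in> sequences n l" by (auto simp: sequences_def msg_seq_def)
  show "increasing (msg_seq p k l m)"
    unfolding increasing_def sorted_wrt_iff_nth_less
  proof (intro allI impI)
    fix i j assume "i < j" "j < length (msg_seq p k l m)"
    then have "i < l" "j < l" "Suc i * p \<le> j * p" 
      by (auto simp: msg_seq_def simp del: mult_Suc intro!: mult_le_mono)
    then show "msg_seq p k l m ! i < msg_seq p k l m ! j"
      using msg_index_bounds(2)[OF assms(1), of k m i] msg_index_bounds(1)[OF assms(1), of j k m] nth
      by simp
  qed
qed

lemma card_agreements_msg_seq:
  assumes p: "prime p" "l \<le> p" and k: "k > 0"
    and m: "m \<in> messages p k" "m' \<in> messages p k" "m \<noteq> m'"
  shows "card (agreements l (msg_seq p k l m) (msg_seq p k l m')) \<le> k - 1"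
proof -
  have "p > 0" using p prime_gt_0_nat by blast
  have "agreements l (msg_seq p k l m) (msg_seq p k l m')
      = {h. h < l \<and> horner p m h k = horner p m' h k}"
    using horner_bounds[OF \<open>p > 0\<close>]
    by (auto simp: agreements_def msg_seq_def msg_index_def eq_nat_nat_iff)
  then show ?thesis using card_horner_agreements_less[OF assms] k by simp
qed




section \<open>The encoder\<close>

lemma run_append: "run n p \<alpha> (xs @ ys) s = Option.bind (run n p \<alpha> xs s) (run n p \<alpha> ys)"
proof (induction xs arbitrary: s)
  case (Cons i xs)
  then show ?case by (cases "step n p \<alpha> i s") auto
qed simp

text \<open>Programs have no loops, but the encoder repeats similar blocks. The states \<open>S i\<close> between the blocks
  are its loop invariant.\<close>

lemma run_loop:
  assumes "\<And>i. i < N \<Longrightarrow> run n p \<alpha> (blk i) (S i) = Some (S (Suc i))"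
  shows "run n p \<alpha> (concat (map blk [0..<N])) (S 0) = Some (S N)"
  using assms by (induction N) (simp_all add: run_append)

lemma num_ops_append: "num_ops \<sigma> (xs @ ys) = num_ops \<sigma> xs + num_ops \<sigma> ys"
  by (simp add: num_ops_def)

lemma num_ops_loop:
  assumes "\<And>i. i < N \<Longrightarrow> num_ops \<sigma> (blk i) = c"
  shows "num_ops \<sigma> (concat (map blk [0..<N])) = N * c"
  using assms by (induction N) (simp_all add: num_ops_append, simp add: num_ops_def)

lemma length_concat_blocks:
  assumes "\<And>i. i < N \<Longrightarrow> length (f i) = L"
  shows "length (concat (map f [0..<N])) = N * L"
  using assms by (induction N) simp_all

lemma nth_concat_blocks:
  assumes "\<And>i. i < N \<Longrightarrow> length (f i) = L" "i < N" "j < L"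
  shows "concat (map f [0..<N]) ! (i * L + j) = f i ! j"
  using assms
proof (induction N)
  case (Suc N)
  have len: "length (concat (map f [0..<N])) = N * L"
    using Suc.prems by (intro length_concat_blocks) simp
  show ?case
  proof (cases "i = N")
    case True
    then show ?thesis by (simp add: nth_append len)
  next
    case False
    then have "i < N" using Suc.prems by simp
    have "i * L + j < Suc i * L" using Suc.prems by simp
    also have "\<dots> \<le> N * L" using \<open>i < N\<close> by (intro mult_le_mono) auto
    finally show ?thesis using Suc \<open>i < N\<close> by (simp add: nth_append len)
  qed
qed simp

text \<open>The registers of sort \<open>\<bbbF>\<^sub>p\<close> hold the \<open>k\<close> message symbols, followed by one block of \<open>2 k + 2\<close> for each
  position \<open>h\<close>: the constant \<open>h\<close>, the initial accumulator 0, and then alternately a product and a new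
  accumulator. Here \<open>b\<close> is the first register of block \<open>h\<close>, the accumulator after \<open>j\<close> rounds is
  register \<open>b + 1 + 2 j\<close>, and the final one is read by \<open>index_block\<close>.\<close>

definition eval_block :: "nat \<Rightarrow> nat \<Rightarrow> 'a instr list" where
  "eval_block k h = (let b = k + h * (2 * k + 2) in
     [P_Const (int h), P_Const 0] @
     concat (map (\<lambda>j. [P_Op Times (b + 1 + 2 * j) b, P_Op Plus (b + 2 + 2 * j) j]) [0..<k]))"

text \<open>Three integers per position; \<open>2 k + 1\<close> is the offset of the final accumulator in its block, and the
  index itself is register \<open>3 h + 2\<close>.\<close>

definition index_block :: "nat \<Rightarrow> nat \<Rightarrow> nat \<Rightarrow> 'a instr list" where
  "index_block p k h =
     [Z_Const (int (h * p + 1)), Z_Lift (k + h * (2 * k + 2) + (2 * k + 1)), Z_Op Plus (3 * h) (3 * h + 1)]"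

text \<open>Register \<open>c\<close> holds the evaluation point, and register \<open>c + 1 + i\<close> its \<open>i\<close>-th power. Starting the
  powers from the constant 1 lets one rule produce all of them.\<close>

definition power_block :: "nat \<Rightarrow> nat \<Rightarrow> 'a::one instr list" where
  "power_block k h = (let c = h * (k + 1) in
     [Q_Lookup (3 * h + 2), Q_Const 1] @
     concat (map (\<lambda>j. [Q_Op Times (c + 1 + j) c]) [0..<k - 1]))"

definition encoder :: "nat \<Rightarrow> nat \<Rightarrow> nat \<Rightarrow> 'a::one instr list" where
  "encoder p k l = concat (map (eval_block k) [0..<l]) @ concat (map (index_block p k) [0..<l])
     @ concat (map (power_block k) [0..<l])"

definition encoder_out :: "nat \<Rightarrow> nat \<Rightarrow> nat \<Rightarrow> nat" where
  "encoder_out k i h = h * (k + 1) + (i + 1)"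

lemma num_ops_encoder:
  assumes "k > 0"
  shows "num_ops P_sort (encoder p k l) = l * (2 * k + 2)"
    "num_ops Z_sort (encoder p k l) = l * 3"
    "num_ops Q_sort (encoder p k l) = l * (k + 1)"
proof -
  have e: "num_ops \<sigma> (eval_block k h) = (if \<sigma> = P_sort then 2 * k + 2 else 0)" for \<sigma> h
    unfolding eval_block_def Let_def num_ops_append
    by (subst num_ops_loop[where c = "if \<sigma> = P_sort then 2 else 0"]) (auto simp: num_ops_def)
  have i: "num_ops \<sigma> (index_block p k h) = (if \<sigma> = Z_sort then 3 else 0)" for \<sigma> h
    by (auto simp: num_ops_def index_block_def)
  have q: "num_ops \<sigma> (power_block k h) = (if \<sigma> = Q_sort then k + 1 else 0)" for \<sigma> h
    unfolding power_block_def Let_def num_ops_append using assms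
    by (subst num_ops_loop[where c = "if \<sigma> = Q_sort then 1 else 0"]) (auto simp: num_ops_def)
  have "num_ops \<sigma> (encoder p k l) = l * (if \<sigma> = P_sort then 2 * k + 2 else 0)
     + (l * (if \<sigma> = Z_sort then 3 else 0) + l * (if \<sigma> = Q_sort then k + 1 else 0))" for \<sigma>
    unfolding encoder_def num_ops_append
    by (simp only: num_ops_loop[OF e] num_ops_loop[OF i] num_ops_loop[OF q])
  note * = this
  show "num_ops P_sort (encoder p k l) = l * (2 * k + 2)"
    "num_ops Z_sort (encoder p k l) = l * 3"
    "num_ops Q_sort (encoder p k l) = l * (k + 1)"
    unfolding * by simp_all
qed

text \<open>The values that block \<open>h\<close> of the evaluation phase has written after \<open>j\<close> rounds. The definitions
  \<open>power_regs\<close> and \<open>index_regs\<close> below describe the other two phases in the same way.\<close>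

definition eval_regs :: "nat \<Rightarrow> nat \<Rightarrow> int list \<Rightarrow> nat \<Rightarrow> int list" where
  "eval_regs p j m h = [int h, 0] @
     concat (map (\<lambda>j. [horner p m h j * int h mod int p, horner p m h (Suc j)]) [0..<j])"

lemma length_eval_regs: "length (eval_regs p j m h) = 2 * j + 2"
  by (induction j) (simp_all add: eval_regs_def)

lemma eval_regs_Suc:
  "eval_regs p (Suc j) m h =
    eval_regs p j m h @ [horner p m h j * int h mod int p, horner p m h (Suc j)]"
  by (simp add: eval_regs_def)

lemma eval_regs_last: "eval_regs p j m h ! (2 * j + 1) = horner p m h j"
proof (cases j)
  case (Suc i)
  then show ?thesis unfolding Suc eval_regs_Suc nth_append length_eval_regs by simp
qed (simp add: eval_regs_def)

lemma eval_regs_0: "eval_regs p j m h ! 0 = int h"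
  by (simp add: eval_regs_def)

lemma run_eval_block:
  assumes "length m = k" "length P = h * (2 * k + 2)" "h < p"
  shows "run n p \<alpha> (eval_block k h) \<lparr>p_regs = m @ P, z_regs = Z, q_regs = Q\<rparr>
    = Some \<lparr>p_regs = m @ P @ eval_regs p k m h, z_regs = Z, q_regs = Q\<rparr>"
proof -
  define b where "b = k + h * (2 * k + 2)"
  define S where "S j = \<lparr>p_regs = (m @ P) @ eval_regs p j m h, z_regs = Z, q_regs = Q\<rparr>" for j
  have len: "length (m @ P) = b" using assms by (simp add: b_def)
  have start: "run n p \<alpha> [P_Const (int h), P_Const 0] \<lparr>p_regs = m @ P, z_regs = Z, q_regs = Q\<rparr> = Some (S 0)"
    using assms by (simp add: push_p_def S_def eval_regs_def)
  have "run n p \<alpha> (concat (map (\<lambda>j. [P_Op Times (b + 1 + 2 * j) b, P_Op Plus (b + 2 + 2 * j) j]) [0..<k])) (S 0)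
      = Some (S k)"
  proof (rule run_loop)
    fix j assume j: "j < k"
    let ?R = "(m @ P) @ eval_regs p j m h"
    have lenR: "length ?R = b + (2 * j + 2)" using len by (simp add: length_eval_regs)
    have acc: "?R ! (b + 1 + 2 * j) = horner p m h j"
      using eval_regs_last[of p j m h] len nth_append_length_plus[of "m @ P" "eval_regs p j m h" "2 * j + 1"]
      by (simp add: add_ac)
    have pt: "?R ! b = int h"
      using eval_regs_0[of p j m h] len nth_append_length_plus[of "m @ P" "eval_regs p j m h" 0] by simp
    let ?t = "horner p m h j * int h mod int p"
    have step1: "step n p \<alpha> (P_Op Times (b + 1 + 2 * j) b) (S j)
        = Some \<lparr>p_regs = ?R @ [?t], z_regs = Z, q_regs = Q\<rparr>"
      unfolding S_def step.simps push_p_def using acc pt lenR by simp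
    have cj: "(?R @ [?t]) ! j = m ! j" using j assms(1) by (simp add: nth_append)
    have tj: "(?R @ [?t]) ! (b + 2 + 2 * j) = ?t"
      using lenR by (metis add.assoc add.commute nth_append_length)
    have step2: "step n p \<alpha> (P_Op Plus (b + 2 + 2 * j) j) \<lparr>p_regs = ?R @ [?t], z_regs = Z, q_regs = Q\<rparr>
        = Some (S (Suc j))"
      unfolding S_def step.simps push_p_def regs.simps cj tj using lenR j assms(1)
      by (simp add: eval_regs_Suc)
    show "run n p \<alpha> [P_Op Times (b + 1 + 2 * j) b, P_Op Plus (b + 2 + 2 * j) j] (S j) = Some (S (Suc j))"
      using step1 step2 by simp
  qed
  then show ?thesis
    unfolding eval_block_def Let_def run_append b_def[symmetric] start by (simp add: S_def)
qed

definition power_regs :: "nat \<Rightarrow> 'a::monoid_mult \<Rightarrow> 'a list" where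
  "power_regs j a = a # map (\<lambda>i. a ^ i) [0..<Suc j]"

lemma run_power_block:
  assumes "length Q = h * (k + 1)" "k > 0" "3 * h + 2 < length Z"
    and "Z ! (3 * h + 2) = int i" "i \<in> {1..n}"
  shows "run n p \<alpha> (power_block k h) \<lparr>p_regs = P, z_regs = Z, q_regs = Q\<rparr>
    = Some \<lparr>p_regs = P, z_regs = Z, q_regs = Q @ power_regs (k - 1) (\<alpha> i)\<rparr>"
proof -
  define c where "c = h * (k + 1)"
  define S where "S j = \<lparr>p_regs = P, z_regs = Z, q_regs = Q @ power_regs j (\<alpha> i)\<rparr>" for j
  have start: "run n p \<alpha> [Q_Lookup (3 * h + 2), Q_Const 1] \<lparr>p_regs = P, z_regs = Z, q_regs = Q\<rparr> = Some (S 0)"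
    using assms by (simp add: push_q_def S_def power_regs_def)
  have "run n p \<alpha> (concat (map (\<lambda>j. [Q_Op Times (c + 1 + j) c]) [0..<k - 1])) (S 0) = Some (S (k - 1))"
  proof (rule run_loop)
    fix j assume "j < k - 1"
    have "power_regs j (\<alpha> i) ! (j + 1) = \<alpha> i ^ j" "power_regs j (\<alpha> i) ! 0 = \<alpha> i"
      by (simp_all add: power_regs_def del: upt_Suc)
    then have "(Q @ power_regs j (\<alpha> i)) ! (c + 1 + j) = \<alpha> i ^ j" "(Q @ power_regs j (\<alpha> i)) ! c = \<alpha> i"
      using assms(1) by (simp_all add: nth_append c_def)
    moreover have "length (Q @ power_regs j (\<alpha> i)) = c + j + 2"
      using assms(1) by (simp add: power_regs_def c_def)
    ultimately show "run n p \<alpha> [Q_Op Times (c + 1 + j) c] (S j) = Some (S (Suc j))"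
      by (simp add: S_def push_q_def) (simp add: power_regs_def)
  qed
  then show ?thesis
    unfolding power_block_def Let_def run_append c_def[symmetric] start by (simp add: S_def)
qed

definition index_regs :: "nat \<Rightarrow> nat \<Rightarrow> int list \<Rightarrow> nat \<Rightarrow> int list" where
  "index_regs p k m h = [int (h * p + 1), horner p m h k, int (msg_index p k m h)]"

text \<open>Each phase writes to one sort of registers only and reads those of the phase before, so the three
  phases are verified as separate loops. The largest integers are the indices, at most \<open>l p < n\<close>.\<close>

lemma outputs_encoder:
  fixes \<alpha> :: "nat \<Rightarrow> 'a::field"
  assumes k: "k > 0" and p: "l \<le> p" "p > 0" "l * p < n" and m: "length m = k"
  shows "outputs n p \<alpha> k l (encoder p k l) (encoder_out k) m
    (mat k l (\<lambda>(i, h). \<alpha> (msg_seq p k l m ! h) ^ i))"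
proof -
  define P where "P N = concat (map (eval_regs p k m) [0..<N])" for N
  define Z where "Z N = concat (map (index_regs p k m) [0..<N])" for N
  define Q where "Q N = concat (map (\<lambda>h. power_regs (k - 1) (\<alpha> (msg_index p k m h))) [0..<N])" for N
  have lenP: "length (P N) = N * (2 * k + 2)" for N
    unfolding P_def by (rule length_concat_blocks) (simp add: length_eval_regs)
  have lenZ: "length (Z N) = N * 3" for N
    unfolding Z_def by (rule length_concat_blocks) (simp add: index_regs_def)
  have lenQ: "length (Q N) = N * (k + 1)" for N
    unfolding Q_def by (rule length_concat_blocks) (use k in \<open>simp add: power_regs_def\<close>)
  have bound: "msg_index p k m h < n" if "h < l" for h
  proof -
    have "Suc h * p \<le> l * p" using that by (intro mult_le_mono) auto
    then show ?thesis using msg_index_bounds(2)[OF p(2), of k m h] p(3) by linarith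
  qed
  have "run n p \<alpha> (concat (map (eval_block k) [0..<l])) \<lparr>p_regs = m @ P 0, z_regs = [], q_regs = []\<rparr>
      = Some \<lparr>p_regs = m @ P l, z_regs = [], q_regs = []\<rparr>"
  proof (rule run_loop[where S = "\<lambda>h. \<lparr>p_regs = m @ P h, z_regs = [], q_regs = []\<rparr>"])
    fix h assume "h < l"
    then show "run n p \<alpha> (eval_block k h) \<lparr>p_regs = m @ P h, z_regs = [], q_regs = []\<rparr>
      = Some \<lparr>p_regs = m @ P (Suc h), z_regs = [], q_regs = []\<rparr>"
      using run_eval_block[OF m lenP, of h p n \<alpha>] p by (simp add: P_def)
  qed
  moreover have "run n p \<alpha> (concat (map (index_block p k) [0..<l])) \<lparr>p_regs = m @ P l, z_regs = Z 0, q_regs = []\<rparr>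
      = Some \<lparr>p_regs = m @ P l, z_regs = Z l, q_regs = []\<rparr>"
  proof (rule run_loop[where S = "\<lambda>h. \<lparr>p_regs = m @ P l, z_regs = Z h, q_regs = []\<rparr>"])
    fix h assume h: "h < l"
    let ?i = "k + h * (2 * k + 2) + (2 * k + 1)"
    have "P l ! (h * (2 * k + 2) + (2 * k + 1)) = eval_regs p k m h ! (2 * k + 1)"
      unfolding P_def using h by (intro nth_concat_blocks) (auto simp: length_eval_regs)
    then have val: "(m @ P l) ! ?i = horner p m h k"
      unfolding eval_regs_last m[symmetric] add.assoc nth_append_length_plus .
    have "Suc h * (2 * k + 2) \<le> l * (2 * k + 2)" using h by (intro mult_le_mono) auto
    then have len: "?i < length (m @ P l)" using m lenP[of l] by simp
    have "int (msg_index p k m h) = int (h * p + 1) + horner p m h k"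
      using horner_bounds[OF p(2), of m h k] by (simp add: msg_index_def)
    then show "run n p \<alpha> (index_block p k h) \<lparr>p_regs = m @ P l, z_regs = Z h, q_regs = []\<rparr>
      = Some \<lparr>p_regs = m @ P l, z_regs = Z (Suc h), q_regs = []\<rparr>"
      using val len lenZ[of h]
      by (simp add: index_block_def push_z_def nth_append Z_def index_regs_def del: of_nat_add of_nat_mult)
  qed
  moreover have "run n p \<alpha> (concat (map (power_block k) [0..<l])) \<lparr>p_regs = m @ P l, z_regs = Z l, q_regs = Q 0\<rparr>
      = Some \<lparr>p_regs = m @ P l, z_regs = Z l, q_regs = Q l\<rparr>"
  proof (rule run_loop[where S = "\<lambda>h. \<lparr>p_regs = m @ P l, z_regs = Z l, q_regs = Q h\<rparr>"])
    fix h assume h: "h < l"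
    have "Z l ! (h * 3 + 2) = index_regs p k m h ! 2"
      unfolding Z_def using h by (intro nth_concat_blocks) (auto simp: index_regs_def)
    then have val: "Z l ! (3 * h + 2) = int (msg_index p k m h)" 
      by (simp add: index_regs_def mult.commute)
    have rng: "msg_index p k m h \<in> {1..n}" using bound[OF h] by (simp add: msg_index_def)
    show "run n p \<alpha> (power_block k h) \<lparr>p_regs = m @ P l, z_regs = Z l, q_regs = Q h\<rparr>
      = Some \<lparr>p_regs = m @ P l, z_regs = Z l, q_regs = Q (Suc h)\<rparr>"
      using run_power_block[OF lenQ k _ val rng] lenZ h by (simp add: Q_def)
  qed
  ultimately have run: "run n p \<alpha> (encoder p k l) (initial_regs m)
      = Some \<lparr>p_regs = m @ P l, z_regs = Z l, q_regs = Q l\<rparr>"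
    by (simp add: encoder_def run_append initial_regs_def P_def Z_def Q_def)
  have small: "\<bar>z\<bar> < int n" if "z \<in> set (Z l)" for z
  proof -
    from that obtain h where h: "h < l" "z \<in> set (index_regs p k m h)"
      by (auto simp: Z_def)
    then have "0 \<le> z" "z \<le> int (msg_index p k m h)"
      using horner_bounds[OF p(2), of m h k] by (auto simp: index_regs_def msg_index_def)
    then show ?thesis using bound[OF h(1)] by linarith
  qed
  have out: "encoder_out k i h < length (Q l)" "Q l ! encoder_out k i h = \<alpha> (msg_seq p k l m ! h) ^ i"
    if "i < k" "h < l" for i h
  proof -
    have "Suc h * (k + 1) \<le> l * (k + 1)" using that by (intro mult_le_mono) auto
    then show "encoder_out k i h < length (Q l)" using that lenQ[of l] by (simp add: encoder_out_def)
    have "Q l ! encoder_out k i h = power_regs (k - 1) (\<alpha> (msg_index p k m h)) ! (i + 1)"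
      unfolding Q_def encoder_out_def using that k
      by (intro nth_concat_blocks) (auto simp: power_regs_def)
    also have "\<dots> = \<alpha> (msg_seq p k l m ! h) ^ i"
      using that by (simp add: power_regs_def msg_seq_def del: upt_Suc)
    finally show "Q l ! encoder_out k i h = \<alpha> (msg_seq p k l m ! h) ^ i" .
  qed
  show ?thesis
    unfolding outputs_def using run small out
    by (intro exI[of _ "\<lparr>p_regs = m @ P l, z_regs = Z l, q_regs = Q l\<rparr>"]) (auto intro!: eq_matI)
qed

section \<open>The sunflower\<close>

theorem proposition3p8:
  fixes k l n :: nat
    and \<alpha> :: "nat \<Rightarrow> 'a::{field,finite}"
  assumes "k \<ge> 2" and "l \<ge> 2" and "n \<ge> 2"
    and "l \<ge> 2 * k - 1" and "n > 2 * l\<^sup>2"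
    and "inj_on \<alpha> {1..n}"
    and "\<And>I J. \<lbrakk>I \<in> sequences n l; J \<in> sequences n l; increasing I; increasing J;
                 card (agreements l I J) \<le> k - 1\<rbrakk>
           \<Longrightarrow> vec_space.rank l (V_mat k l I J \<alpha>) = 2 * k - 1"
  shows "\<exists>p. prime p \<and> real n / (2 * real l) \<le> real p \<and> real p \<le> real n / real l \<and>
           (\<exists>\<F> :: 'a vec set set. RS_sunflower l k 1 \<F> \<and> card \<F> \<ge> p ^ k \<and>
              (\<exists>prog out. encodes_into n p \<alpha> k l prog out \<F> \<and>
                 num_ops P_sort prog \<le> op_factor * (k * l) \<and>
                 num_ops Z_sort prog \<le> op_factor * l \<and>
                 num_ops Q_sort prog \<le> op_factor * (k * l)))"
proof -
  obtain p where p: "prime p" "n \<le> 2 * l * p" "l * p < n" "l \<le> p"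
    using prime_between_n_div_2l_and_n_div_l[of l n] assms(2,5) by auto
  have p0: "p > 0" and k0: "k > 0" and kl: "k \<le> l"
    using p(1) assms(1,4) by (auto simp: prime_gt_0_nat)
  define \<beta> where "\<beta> m = vec l (\<lambda>h. \<alpha> (msg_seq p k l m ! h))" for m
  define petal where "petal m = RS_code l k (\<beta> m)" for m
  let ?M = "messages p k"
  note seq = msg_seq_props[OF p0 less_imp_le[OF p(3)]]
  have \<beta>_inj: "inj_on (\<lambda>h. \<beta> m $ h) {..<l}" for m
  proof (rule inj_onI)
    fix i j assume ij: "i \<in> {..<l}" "j \<in> {..<l}" "\<beta> m $ i = \<beta> m $ j"
    have len: "length (msg_seq p k l m) = l" and sub: "set (msg_seq p k l m) \<subseteq> {1..n}"
      using seq(1)[of k m] by (auto simp: sequences_def)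
    have "distinct (msg_seq p k l m)"
      using seq(2)[of k m] by (simp add: increasing_def strict_sorted_iff)
    moreover have "msg_seq p k l m ! h \<in> {1..n}" if "h < l" for h
      using that len sub by (metis nth_mem subsetD)
    then have "msg_seq p k l m ! i = msg_seq p k l m ! j"
      using ij by (intro inj_onD[OF assms(6)]) (auto simp: \<beta>_def)
    ultimately show "i = j" using ij len by (simp add: nth_eq_iff_index_eq)
  qed
  have dim: "is_subspace_of_dim l k (petal m)"
    and dim1: "is_subspace_of_dim l 1 (RS_code l 1 (\<beta> m))" for m
    using RS_code_dim_and_generator(1)[OF \<beta>_inj] k0 kl by (auto simp: petal_def)
  have meet: "petal m \<inter> petal m' = RS_code l 1 (\<beta> m'')"
    if "m \<in> ?M" "m' \<in> ?M" "m \<noteq> m'" for m m' m''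
    unfolding petal_def RS_code_1
    by (rule RS_codes_meet_in_constants[where \<alpha> = \<alpha>, OF k0 assms(7)])
      (use seq card_agreements_msg_seq[OF p(1,4) k0 that] in \<open>auto simp: \<beta>_def\<close>)
  \<comment> \<open>A code equal to two different petals would be its own intersection, of dimension 1 and of dimension \<open>k\<close>.\<close>
  have inj: "inj_on petal ?M"
  proof (rule inj_onI, rule ccontr)
    fix m m' assume "m \<in> ?M" "m' \<in> ?M" "petal m = petal m'" "m \<noteq> m'"
    then have "petal m = RS_code l 1 (\<beta> m)" using meet[of m m' m] by simp
    then show False using dim[of m] dim1[of m] assms(1) by (simp add: is_subspace_of_dim_def)
  qed
  have "card (petal ` ?M) = card ?M" using inj by (rule card_image)
  also have "\<dots> = card {m. set m \<subseteq> {0..<int p} \<and> length m = k}"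
    by (rule arg_cong[where f = card]) (auto simp: messages_def)
  also have "\<dots> = p ^ k" by (simp add: card_lists_length_eq)
  finally have card: "card (petal ` ?M) \<ge> p ^ k" by simp
  \<comment> \<open>The field has at least \<open>n \<ge> l\<close> elements because \<open>\<alpha>\<close> is injective.\<close>
  have "l * 1 \<le> l * p" using p0 by (intro mult_le_mono) auto
  then have "l \<le> n" using p(3) by linarith
  also have "n = card (\<alpha> ` {1..n})" using assms(6) by (simp add: card_image)
  also have "\<dots> \<le> card (UNIV :: 'a set)" by (intro card_mono) auto
  finally have lq: "l \<le> card (UNIV :: 'a set)" .
  \<comment> \<open>The center does not depend on the evaluation points; \<open>\<beta> []\<close> is an arbitrary choice.\<close>
  have sunflower: "RS_sunflower l k 1 (petal ` ?M)"
    unfolding RS_sunflower_def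
  proof (intro conjI exI[of _ "RS_code l 1 (\<beta> [])"] ballI impI)
    fix C assume "C \<in> petal ` ?M"
    then obtain m where C: "C = petal m" by auto
    show "is_RS_code l k C" unfolding is_RS_code_def
      by (rule bexI[of _ "\<beta> m"]) (use \<beta>_inj in \<open>auto simp: C petal_def \<beta>_def\<close>)
    show "is_subspace_of_dim l k C" using dim C by simp
  next
    fix C D assume "C \<in> petal ` ?M" "D \<in> petal ` ?M" "C \<noteq> D"
    then show "C \<inter> D = RS_code l 1 (\<beta> [])" using meet by blast
  qed (use assms(1) kl lq dim1 in auto)
  have "encodes_into n p \<alpha> k l (encoder p k l) (encoder_out k) (petal ` ?M)"
    unfolding encodes_into_def
  proof (intro exI[of _ petal] conjI ballI inj)
    fix m assume m: "m \<in> ?M"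
    then show "petal m \<in> petal ` ?M" by simp
    let ?G = "transpose_mat (vandermonde l k (\<beta> m))"
    have "?G = mat k l (\<lambda>(i, h). \<alpha> (msg_seq p k l m ! h) ^ i)"
      by (rule eq_matI) (auto simp: vandermonde_def \<beta>_def)
    moreover have "length m = k" using m by (simp add: messages_def)
    ultimately have "outputs n p \<alpha> k l (encoder p k l) (encoder_out k) m ?G"
      using outputs_encoder[OF k0 p(4) p0 p(3), of m \<alpha>] by metis
    moreover have "is_generator_matrix l k (petal m) ?G"
      unfolding petal_def by (rule RS_code_dim_and_generator(2)[OF \<beta>_inj k0 kl])
    ultimately show "\<exists>G. outputs n p \<alpha> k l (encoder p k l) (encoder_out k) m G
        \<and> is_generator_matrix l k (petal m) G" by blast
  qed
  moreover have "l * (2 * k + 2) \<le> l * (4 * k)" "l * (k + 1) \<le> l * (4 * k)"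
    using k0 by (intro mult_le_mono; simp)+
  then have "num_ops P_sort (encoder p k l :: 'a instr list) \<le> op_factor * (k * l)"
    "num_ops Z_sort (encoder p k l :: 'a instr list) \<le> op_factor * l"
    "num_ops Q_sort (encoder p k l :: 'a instr list) \<le> op_factor * (k * l)"
    using k0 by (simp_all add: num_ops_encoder op_factor_def mult_ac)
  moreover have "real n \<le> real (2 * l * p)" "real (l * p) \<le> real n" using p by linarith+
  then have "real n / (2 * real l) \<le> real p" "real p \<le> real n / real l"
    using assms(2) by (simp_all add: field_simps)
  ultimately show ?thesis
    using p(1) sunflower card by blast
qed

end
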